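(* Let $G$ be an infinite graph. Let $\Omega'(G)$, $\Omega(G)$ and $\Omega_E(G)$ be the sets of topological ends, ends and edge-ends of $G$, and let $\phi:\Omega'(G)\to\Omega(G)$ and $f:\Omega(G)\to\Omega_E(G)$, $f([r])=[r]_E$, be the canonical maps. The following statements are equivalent: 1. There exists a well-defined and injective function $f_E:\Omega'(G)\to\Omega_E(G)$ such that $f_E=f\circ\phi$ (that is, the triangle formed by $f_E$, $\phi$ and $f$ commutes). 2. $G$ is end-correlated, i.e. any two rays of $G$ that are edge-equivalent and non-dominated are (vertex-)equivalent. 3. For every finite set $F\subset V(G)$ and every vertex $v\in V(G)$, there is at most one connected component $C$ of $G\setminus F$ such that $\mathcal{C}_v\cap C$ contains a non-dominated ray, where $\mathcal{C}_v$ is the edge class of $v$.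
   Context: Rays and ends. A ray in $G$ is a one-way infinite path; a tail of a ray is an infinite connected subgraph of it. Let $\mathcal{R}(G)$ be the set of rays of $G$. Two rays $r,s$ are (vertex-)equivalent, $r\sim s$, if for every finite $X\subset V(G)$ they have tails in the same connected component of $G\setminus X$. The equivalence class of $r$ is denoted $[r]$, and $\Omega(G)=\mathcal{R}(G)/\sim$ is the set of ends of $G$. Edge-ends. Two rays $r,s$ are edge-equivalent, $r\sim_E s$, if for every finite $X\subset E(G)$ they have tails in the same connected component of $G\setminus X$. The class of $r$ is $[r]_E$, and $\Omega_E(G)=\mathcal{R}(G)/\sim_E$ is the set of edge-ends. The map $f:\Omega(G)\to\Omega_E(G)$, $[r]\mapsto[r]_E$, is well defined and surjective. Domination. A vertex $v$ dominates a ray $r$ if there are infinitely many paths from $v$ to $r$ that are pairwise disjoint except at $v$. A ray is non-dominated if no vertex of $G$ dominates it. Equivalent rays are dominated by the same vertices, and an end is non-dominated if its rays are non-dominated. Topological ends. View $G$ as a $1$-complex: each edge is a copy of $[0,1]$, and basic open neighbourhoods of a vertex $x$ are unions of half-open intervals $[x,z_e)$, one on each edge $e$ at $x$, with the inner points $z_e$ chosen arbitrarily. Consider decreasing sequences $A_0\supset A_1\supset A_2\supset\cdots$ of non-empty connected open subsets of this space such that each boundary $\partial A_n$ is compact and $\bigcap_{n\in\mathbb{N}}\overline{A_n}=\emptyset$. Two such sequences $\langle A_n\rangle$, $\langle B_n\rangle$ are equivalent if for every $n$ there exist $m,k$ with $A_n\supset B_m$ and $B_n\supset A_k$. The equivalence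 classes are the topological ends of $G$; their set is $\Omega'(G)$. The map $\phi$. By a known theorem of Diestel and Kühn there is a canonical injective map $\phi:\Omega'(G)\to\Omega(G)$ whose image is exactly the set of non-dominated ends of $G$: if $\langle A_n\rangle$ represents $\epsilon\in\Omega'(G)$, then $\phi(\epsilon)$ is the unique end of $G$ whose rays have a tail in every $A_n$. Edge classes. Vertices $u,v$ are edge-equivalent, $u\sim_E v$, if for every finite $F\subset E(G)$ they lie in the same connected component of $G\setminus F$. The edge class of $v$ is $\mathcal{C}_v=\{u\in V(G):u\sim_E v\}$. A set of vertices such as $\mathcal{C}_v$ or $\mathcal{C}_v\cap C$ (the vertices of $\mathcal{C}_v$ lying in $C$) is said to contain a ray $r$ if $r$ passes through infinitely many elements of that set. *)

theory Defs
  imports "HOL-Analysis.Analysis"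
begin

section \<open>Graphs, components, rays and paths\<close>

record 'a ugraph =
  verts :: "'a set"
  edges :: "'a set set"

text \<open>Graphs are simple and undirected, of arbitrary cardinality, and need not be connected.\<close>

definition is_graph :: "'a ugraph \<Rightarrow> bool" where
  "is_graph G \<longleftrightarrow> (\<forall>e\<in>edges G. e \<subseteq> verts G \<and> card e = 2)"

definition delete_verts :: "'a ugraph \<Rightarrow> 'a set \<Rightarrow> 'a ugraph" where
  "delete_verts G X = \<lparr>verts = verts G - X, edges = {e \<in> edges G. e \<inter> X = {}}\<rparr>"

definition delete_edges :: "'a ugraph \<Rightarrow> 'a set set \<Rightarrow> 'a ugraph" where
  "delete_edges G X = \<lparr>verts = verts G, edges = edges G - X\<rparr>"

definition adj :: "'a ugraph \<Rightarrow> ('a \<times> 'a) set" where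
  "adj G = {(u, v). {u, v} \<in> edges G}"

text \<open>A connected component is represented by its vertex set.\<close>

definition graph_components :: "'a ugraph \<Rightarrow> 'a set set" where
  "graph_components G = {{u \<in> verts G. (v, u) \<in> (adj G)\<^sup>*} | v. v \<in> verts G}"

text \<open>A ray is represented by the unique enumeration of its vertices along the ray, starting at
  its vertex of degree one.\<close>

definition is_ray :: "'a ugraph \<Rightarrow> (nat \<Rightarrow> 'a) \<Rightarrow> bool" where
  "is_ray G r \<longleftrightarrow> inj r \<and> range r \<subseteq> verts G \<and> (\<forall>i. {r i, r (Suc i)} \<in> edges G)"

definition ray_tail :: "nat \<Rightarrow> (nat \<Rightarrow> 'a) \<Rightarrow> (nat \<Rightarrow> 'a)" where
  "ray_tail n r = (\<lambda>i. r (n + i))"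

text \<open>Since \<open>C\<close> is only a vertex set, that a tail lies in the component also requires the edges of
  the tail to be edges of \<open>H\<close>.\<close>

definition has_tail_in_component :: "'a ugraph \<Rightarrow> 'a set \<Rightarrow> (nat \<Rightarrow> 'a) \<Rightarrow> bool" where
  "has_tail_in_component H C r \<longleftrightarrow>
     (\<exists>n. is_ray H (ray_tail n r) \<and> range (ray_tail n r) \<subseteq> C)"

definition is_path :: "'a ugraph \<Rightarrow> 'a list \<Rightarrow> bool" where
  "is_path G p \<longleftrightarrow> p \<noteq> [] \<and> distinct p \<and> set p \<subseteq> verts G \<and>
     (\<forall>i. Suc i < length p \<longrightarrow> {p ! i, p ! Suc i} \<in> edges G)"


section \<open>Ends and edge-ends\<close>

definition ray_equiv :: "'a ugraph \<Rightarrow> ((nat \<Rightarrow> 'a) \<times> (nat \<Rightarrow> 'a)) set" where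
  "ray_equiv G = {(r, s). is_ray G r \<and> is_ray G s \<and>
     (\<forall>X. finite X \<and> X \<subseteq> verts G \<longrightarrow>
        (\<exists>C \<in> graph_components (delete_verts G X).
           has_tail_in_component (delete_verts G X) C r \<and>
           has_tail_in_component (delete_verts G X) C s))}"

definition ends :: "'a ugraph \<Rightarrow> (nat \<Rightarrow> 'a) set set" where
  "ends G = {r. is_ray G r} // ray_equiv G"

definition ray_edge_equiv :: "'a ugraph \<Rightarrow> ((nat \<Rightarrow> 'a) \<times> (nat \<Rightarrow> 'a)) set" where
  "ray_edge_equiv G = {(r, s). is_ray G r \<and> is_ray G s \<and>
     (\<forall>X. finite X \<and> X \<subseteq> edges G \<longrightarrow>
        (\<exists>C \<in> graph_components (delete_edges G X).
           has_tail_in_component (delete_edges G X) C r \<and>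
           has_tail_in_component (delete_edges G X) C s))}"

definition edge_ends :: "'a ugraph \<Rightarrow> (nat \<Rightarrow> 'a) set set" where
  "edge_ends G = {r. is_ray G r} // ray_edge_equiv G"

text \<open>The map \<open>[r] \<mapsto> [r]\<^sub>E\<close>: the image below is a singleton, as equivalent rays are edge-equivalent.\<close>

definition end_to_edge_end :: "'a ugraph \<Rightarrow> (nat \<Rightarrow> 'a) set \<Rightarrow> (nat \<Rightarrow> 'a) set" where
  "end_to_edge_end G \<omega> = the_elem ((\<lambda>r. ray_edge_equiv G `` {r}) ` \<omega>)"

definition dominates :: "'a ugraph \<Rightarrow> 'a \<Rightarrow> (nat \<Rightarrow> 'a) \<Rightarrow> bool" where
  "dominates G v r \<longleftrightarrow> (\<exists>P. infinite P \<and>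
     (\<forall>p\<in>P. is_path G p \<and> hd p = v \<and> last p \<in> range r) \<and>
     (\<forall>p\<in>P. \<forall>q\<in>P. p \<noteq> q \<longrightarrow> set p \<inter> set q = {v}))"

definition nondominated :: "'a ugraph \<Rightarrow> (nat \<Rightarrow> 'a) \<Rightarrow> bool" where
  "nondominated G r \<longleftrightarrow> \<not> (\<exists>v\<in>verts G. dominates G v r)"

definition end_correlated :: "'a ugraph \<Rightarrow> bool" where
  "end_correlated G \<longleftrightarrow> (\<forall>r s. is_ray G r \<and> is_ray G s \<and>
     (r, s) \<in> ray_edge_equiv G \<and> nondominated G r \<and> nondominated G s \<longrightarrow>
     (r, s) \<in> ray_equiv G)"

definition edge_class :: "'a ugraph \<Rightarrow> 'a \<Rightarrow> 'a set" where
  "edge_class G v = {u \<in> verts G. \<forall>F. finite F \<and> F \<subseteq> edges G \<longrightarrow>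
     (\<exists>C \<in> graph_components (delete_edges G F). u \<in> C \<and> v \<in> C)}"

definition contains_ray :: "'a set \<Rightarrow> (nat \<Rightarrow> 'a) \<Rightarrow> bool" where
  "contains_ray S r \<longleftrightarrow> infinite (range r \<inter> S)"


section \<open>The 1-complex of a graph and its topological ends\<close>

text \<open>Points of the 1-complex are given by barycentric coordinates. For an edge \<open>{u, v}\<close> the map
  \<open>edge_point u v\<close> identifies \<open>[0,1]\<close> with that edge, \<open>0\<close> corresponding to \<open>u\<close> and \<open>1\<close> to \<open>v\<close>;
  in particular \<open>edge_point u v t = edge_point v u (1 - t)\<close>.\<close>

definition vertex_point :: "'a \<Rightarrow> 'a \<Rightarrow> real" where
  "vertex_point x = (\<lambda>w. if w = x then 1 else 0)"

definition edge_point :: "'a \<Rightarrow> 'a \<Rightarrow> real \<Rightarrow> 'a \<Rightarrow> real" where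
  "edge_point u v t = (\<lambda>w. if w = u then 1 - t else if w = v then t else 0)"

text \<open>The star \<open>open_star G x z\<close> is the union of the half-open intervals from \<open>x\<close> to the inner
  point \<open>edge_point x y (z y)\<close> on each edge \<open>{x, y}\<close>. The lengths \<open>z y\<close> need not be bounded away
  from 0, so at vertices of infinite degree this is finer than the metric topology.\<close>

definition open_star :: "'a ugraph \<Rightarrow> 'a \<Rightarrow> ('a \<Rightarrow> real) \<Rightarrow> ('a \<Rightarrow> real) set" where
  "open_star G x z = insert (vertex_point x)
     {edge_point x y t | y t. {x, y} \<in> edges G \<and> 0 \<le> t \<and> t < z y}"

definition complex_topology :: "'a ugraph \<Rightarrow> ('a \<Rightarrow> real) topology" where
  "complex_topology G = topology_generated_by
     ({open_star G x z | x z. x \<in> verts G \<and> (\<forall>y. 0 < z y \<and> z y < 1)} \<union>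
      {edge_point u v ` {a<..<b} | u v a b. {u, v} \<in> edges G \<and> 0 \<le> a \<and> a < b \<and> b \<le> 1})"

definition is_top_end_seq :: "'a ugraph \<Rightarrow> (nat \<Rightarrow> ('a \<Rightarrow> real) set) \<Rightarrow> bool" where
  "is_top_end_seq G A \<longleftrightarrow> decseq A \<and>
     (\<forall>n. A n \<noteq> {} \<and> openin (complex_topology G) (A n) \<and> connectedin (complex_topology G) (A n) \<and>
        compactin (complex_topology G) (complex_topology G frontier_of A n)) \<and>
     (\<Inter>n. complex_topology G closure_of A n) = {}"

definition top_end_equiv ::
  "'a ugraph \<Rightarrow> ((nat \<Rightarrow> ('a \<Rightarrow> real) set) \<times> (nat \<Rightarrow> ('a \<Rightarrow> real) set)) set" where
  "top_end_equiv G = {(A, B). is_top_end_seq G A \<and> is_top_end_seq G B \<and>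
     (\<forall>n. \<exists>m k. B m \<subseteq> A n \<and> A k \<subseteq> B n)}"

definition top_ends :: "'a ugraph \<Rightarrow> (nat \<Rightarrow> ('a \<Rightarrow> real) set) set set" where
  "top_ends G = {A. is_top_end_seq G A} // top_end_equiv G"

definition has_tail_in_space :: "('a \<Rightarrow> real) set \<Rightarrow> (nat \<Rightarrow> 'a) \<Rightarrow> bool" where
  "has_tail_in_space U r \<longleftrightarrow> (\<exists>n. \<forall>i\<ge>n. edge_point (r i) (r (Suc i)) ` {0..1} \<subseteq> U)"

definition top_end_to_end ::
  "'a ugraph \<Rightarrow> (nat \<Rightarrow> ('a \<Rightarrow> real) set) set \<Rightarrow> (nat \<Rightarrow> 'a) set" where
  "top_end_to_end G \<epsilon> =
     (THE \<omega>. \<omega> \<in> ends G \<and> (\<forall>A\<in>\<epsilon>. \<forall>r\<in>\<omega>. \<forall>n. has_tail_in_space (A n) r))"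

end

theory Submission
  imports Defs
begin

text \<open>
  The ends that matter are those with a countable basis: a decreasing sequence of components \<open>C n\<close>,
  each left over by the deletion of finitely many vertices, such that every vertex eventually lies
  neither in \<open>C n\<close> nor next to it. The rays with a tail in every \<open>C n\<close> form one end
  (\<open>ray_follows_equiv_iff\<close>). This end is non-dominated, since the finite boundary of a late \<open>C n\<close>
  separates a given vertex from it, and every non-dominated end has a basis
  (\<open>nondominated_has_end_basis\<close>).

  Topological ends are the same thing in the 1-complex. Let \<open>region C\<close> be the open set spanned by
  the vertices in \<open>C\<close> and the half-open edges at them. The regions of a basis form a sequence that
  represents a topological end. Conversely, the frontier of a member of such a sequence is compact,
  hence it contains only finitely many vertices and meets only finitely many edges in inner points.
  Deleting these vertices and the ends of these edges yields components whose regions interlace with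
  the sequence (\<open>top_end_seq_has_end_basis\<close>). So \<open>\<phi>\<close> maps the class of a
  sequence to the end of the rays with tails in all its members, and \<open>\<phi>\<close> is a bijection onto the
  non-dominated ends (\<open>top_end_equiv_iff_ray_equiv\<close>, \<open>top_end_to_end_eq\<close>). Therefore \<open>f \<circ> \<phi>\<close> is
  injective iff edge-equivalent non-dominated rays are equivalent.

  That the condition on edge classes follows from end-correlation is direct: two rays that meet the
  same edge class infinitely often are edge-equivalent. For the converse, let \<open>r\<close> and \<open>s\<close> be
  edge-equivalent and non-dominated, with tails in different components after the deletion of a
  finite set \<open>X\<close>. If finitely many edges separated every vertex of \<open>X\<close> from \<open>r\<close>, then the
  component containing the tails of \<open>r\<close> and \<open>s\<close> after deleting these edges would avoid \<open>X\<close> and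
  connect the tails. So some \<open>x \<in> X\<close> cannot be separated from \<open>r\<close>, nor from \<open>s\<close>, by finitely
  many edges (\<open>separator_has_edge_dominating_vertex\<close>). It remains to replace \<open>r\<close> by an equivalent
  ray through infinitely many vertices of the edge class of \<open>x\<close>, and \<open>s\<close> likewise. This is the
  main construction. Since all approaches to the end cross the finite boundary of \<open>C n\<close>, a pigeonhole
  argument finds a vertex of the edge class of \<open>x\<close> that finitely many edges do not separate from the
  end even if only \<open>C n\<close>, without the vertices used before, is available for the connection. The
  paths between successive vertices of this kind are joined to a ray (\<open>linked_ray\<close>).
\<close>

section \<open>Reachability, paths and components\<close>

lemma adj_iff: "(u, v) \<in> adj H \<longleftrightarrow> {u, v} \<in> edges H"
  by (simp add: adj_def)

lemma reach_sym: "(u, v) \<in> (adj H)\<^sup>* \<Longrightarrow> (v, u) \<in> (adj H)\<^sup>*"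
  by (rule symD[OF sym_rtrancl]) (auto simp: sym_def adj_iff insert_commute)

lemma adj_delete_verts:
  "(u, v) \<in> adj (delete_verts G X) \<longleftrightarrow> {u, v} \<in> edges G \<and> u \<notin> X \<and> v \<notin> X"
  by (auto simp: adj_def delete_verts_def)

lemma adj_delete_edges: "(u, v) \<in> adj (delete_edges G F) \<longleftrightarrow> {u, v} \<in> edges G \<and> {u, v} \<notin> F"
  by (auto simp: adj_def delete_edges_def)

lemma verts_delete [simp]:
  "verts (delete_verts G X) = verts G - X" "verts (delete_edges G F) = verts G"
  by (simp_all add: delete_verts_def delete_edges_def)

lemma is_path_iff_successively:
  "is_path G p \<longleftrightarrow> p \<noteq> [] \<and> distinct p \<and> set p \<subseteq> verts G \<and>
     successively (\<lambda>a b. {a, b} \<in> edges G) p"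
  by (simp add: is_path_def successively_conv_nth)

lemma is_path_append:
  assumes "is_path G p" "is_path G q" "last p = hd q" "set p \<inter> set (tl q) = {}"
  shows "is_path G (p @ tl q)"
  using assms
  by (cases q) (auto simp: is_path_iff_successively successively_append_iff successively_Cons)

lemma path_within:
  assumes "(u, v) \<in> (Restr (adj G) S)\<^sup>*" "u \<in> S" "S \<subseteq> verts G"
  obtains p where "is_path G p" "hd p = u" "last p = v" "set p \<subseteq> S"
proof -
  from assms(1,2) have "\<exists>p. is_path G p \<and> hd p = u \<and> last p = v \<and> set p \<subseteq> S"
  proof (induction rule: converse_rtrancl_induct)
    case base
    then show ?case
      using assms(3) by (intro exI[of _ "[v]"]) (auto simp: is_path_def)
  next
    case (step a b)
    then obtain p where p: "is_path G p" "hd p = b" "last p = v" "set p \<subseteq> S" by auto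
    show ?case
    proof (cases "a \<in> set p")
      case True
      then obtain xs ys where "p = xs @ a # ys" by (meson split_list)
      with p show ?thesis
        by (intro exI[of _ "a # ys"]) (auto simp: is_path_iff_successively successively_append_iff)
    next
      case False
      with p step.hyps step.prems assms(3) show ?thesis
        by (intro exI[of _ "a # p"])
          (auto simp: is_path_iff_successively successively_Cons adj_iff)
    qed
  qed
  with that show ?thesis by blast
qed

lemma path_reach:
  assumes "is_path G p" "set p \<subseteq> S"
  shows "(hd p, last p) \<in> (Restr (adj G) S)\<^sup>*"
  using assms
proof (induction p rule: induct_list012)
  case (3 x y zs)
  then have "(y, last (y # zs)) \<in> (Restr (adj G) S)\<^sup>*"
    by (auto simp: is_path_iff_successively)
  moreover have "(x, y) \<in> Restr (adj G) S"
    using 3(3,4) by (auto simp: is_path_iff_successively adj_iff)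
  ultimately show ?case by (auto intro: converse_rtrancl_into_rtrancl)
qed (auto simp: is_path_def)

text \<open>
  Paths that advance through a shrinking sequence of regions, each path leaving behind the region
  of the next one, concatenate to a ray: no vertex can be met twice.
\<close>
lemma concatenate_paths:
  assumes P: "\<And>k. is_path G (P k)" "\<And>k. hd (P k) = x k" "\<And>k. last (P k) = x (Suc k)"
    and nontrivial: "\<And>k. x (Suc k) \<noteq> x k"
    and inside: "\<And>k. set (P k) \<subseteq> insert (x k) (S k)"
    and leave: "\<And>k. set (P k) \<inter> S (Suc k) = {}"
    and shrink: "\<And>k. S (Suc k) \<subseteq> S k"
    and start: "x 0 \<notin> S 0"
  obtains R where "is_ray G R" "range x \<subseteq> range R" "\<And>k. \<exists>N. \<forall>i\<ge>N. R i \<in> S k"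
proof -
  define Q where "Q = rec_nat [x 0] (\<lambda>n q. q @ tl (P n))"
  have Q0: "Q 0 = [x 0]" and QS: "Q (Suc n) = Q n @ tl (P n)" for n by (simp_all add: Q_def)
  have ne: "P k \<noteq> []" for k using P(1)[of k] by (simp add: is_path_def)
  have tl_ne: "tl (P k) \<noteq> []" for k
    using P(2,3)[of k] nontrivial[of k] ne[of k] by (cases "P k") (auto split: if_splits)
  have xS: "x k \<notin> S k" for k
  proof (cases k)
    case (Suc j)
    then show ?thesis using leave[of j] P(3)[of j] last_in_set[OF ne[of j]] by auto
  qed (simp add: start)
  have tl_S: "set (tl (P k)) \<subseteq> S k" for k
    using inside[of k] P(1,2)[of k] ne[of k] by (cases "P k") (auto simp: is_path_def)
  have Q: "is_path G (Q n) \<and> last (Q n) = x n \<and> set (Q n) \<inter> S n = {} \<and> n < length (Q n)" for n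
  proof (induction n)
    case 0
    have "x 0 \<in> verts G" using P(1,2)[of 0] ne[of 0] by (metis hd_in_set is_path_def subsetD)
    then show ?case by (simp add: Q0 is_path_def start)
  next
    case (Suc n)
    have "is_path G (Q (Suc n))"
      unfolding QS using Suc tl_S[of n] P(1,2)[of n] by (intro is_path_append) auto
    moreover have "last (Q (Suc n)) = x (Suc n)"
      unfolding QS using tl_ne[of n] P(3)[of n] by (simp add: last_tl)
    moreover have "set (Q (Suc n)) \<inter> S (Suc n) = {}"
      unfolding QS using Suc shrink[of n] leave[of n] list.set_sel(2)[OF ne[of n]] by auto
    moreover have "Suc n < length (Q (Suc n))"
      unfolding QS using Suc tl_ne[of n] by (cases "tl (P n)") auto
    ultimately show ?case by blast
  qed
  have len: "length (Q m) \<le> length (Q n)" if "m \<le> n" for m n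
    using that by (induction rule: dec_induct) (auto simp: QS)
  have nth: "Q n ! i = Q m ! i" if "m \<le> n" "i < length (Q m)" for m n i
    using that(1)
  proof (induction rule: dec_induct)
    case (step n)
    then show ?case using len[of m n] that(2) by (simp add: QS nth_append)
  qed simp
  define R where "R i = Q i ! i" for i
  have R_eq: "R i = Q n ! i" if "i < length (Q n)" for i n
    using nth[of i n i] nth[of n i i] that Q[of i] unfolding R_def by (cases "i \<le> n") auto
  have "is_ray G R"
    unfolding is_ray_def
  proof (intro conjI allI)
    show "inj R"
    proof (rule linorder_injI)
      fix i j :: nat assume "i < j"
      then show "R i \<noteq> R j"
        using R_eq[of i j] R_eq[of j j] Q[of j] by (auto simp: is_path_def nth_eq_iff_index_eq)
    qed
    show "range R \<subseteq> verts G"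
    proof (rule image_subsetI)
      fix i show "R i \<in> verts G"
        using Q[of i] nth_mem[of i "Q i"] unfolding R_def is_path_def by blast
    qed
    show "{R i, R (Suc i)} \<in> edges G" for i
    proof -
      have "is_path G (Q (Suc i))" "Suc i < length (Q (Suc i))" using Q[of "Suc i"] by blast+
      then show ?thesis using R_eq[of i "Suc i"] R_eq[of "Suc i" "Suc i"] by (simp add: is_path_def)
    qed
  qed
  moreover have "x k \<in> range R" for k
  proof -
    have "Q k \<noteq> []" using Q[of k] by (simp add: is_path_def)
    then have "x k \<in> set (Q k)" using Q[of k] last_in_set by metis
    then obtain i where "i < length (Q k)" "Q k ! i = x k" by (meson in_set_conv_nth)
    then show ?thesis using R_eq[of i k] by (metis rangeI)
  qed
  moreover have "\<exists>N. \<forall>i\<ge>N. R i \<in> S k" for k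
  proof (intro exI allI impI)
    fix i assume i: "length (Q k) \<le> i"
    have S_mono: "S m \<subseteq> S k" if "k \<le> m" for m
      using that by (induction rule: dec_induct) (use shrink in auto)
    have late: "\<forall>i<length (Q n). length (Q k) \<le> i \<longrightarrow> Q n ! i \<in> S k" if "k \<le> n" for n
      using that
    proof (induction rule: dec_induct)
      case (step n)
      show ?case
      proof (intro allI impI)
        fix i assume "i < length (Q (Suc n))" "length (Q k) \<le> i"
        moreover have "tl (P n) ! j \<in> S k" if "j < length (tl (P n))" for j
          using nth_mem[OF that] tl_S[of n] S_mono[OF step.hyps(1)] by blast
        ultimately show "Q (Suc n) ! i \<in> S k"
          using step.IH by (auto simp: QS nth_append)
      qed
    qed simp
    have "k \<le> i" using Q[of k] i by auto
    then show "R i \<in> S k" using late[of i] Q[of i] i unfolding R_def by blast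
  qed
  ultimately show ?thesis using that by blast
qed

text \<open>The vertex set of the component of \<open>H\<close> in which \<open>r\<close> has a tail, if there is one.\<close>
definition ray_component :: "'a ugraph \<Rightarrow> (nat \<Rightarrow> 'a) \<Rightarrow> 'a set" where
  "ray_component H r = {u \<in> verts H. \<exists>N. \<forall>i\<ge>N. (u, r i) \<in> (adj H)\<^sup>*}"

lemma ray_reach:
  assumes "is_ray H (ray_tail n r)" "n \<le> i" "n \<le> j"
  shows "(r i, r j) \<in> (adj H)\<^sup>*"
proof -
  have "(r n, r k) \<in> (adj H)\<^sup>*" if "n \<le> k" for k
    using that
  proof (induction rule: dec_induct)
    case (step k)
    have "{r k, r (Suc k)} \<in> edges H"
      using assms(1) step.hyps unfolding is_ray_def ray_tail_def
      by (metis add_Suc_right le_add_diff_inverse)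
    then show ?case using step.IH by (auto simp: adj_iff intro: rtrancl_into_rtrancl)
  qed simp
  then show ?thesis using assms(2,3) by (meson reach_sym rtrancl_trans)
qed

lemma ray_component_eq:
  assumes "is_ray H (ray_tail n r)" "n \<le> i"
  shows "ray_component H r = {u \<in> verts H. (r i, u) \<in> (adj H)\<^sup>*}" "r i \<in> verts H"
proof -
  show "ray_component H r = {u \<in> verts H. (r i, u) \<in> (adj H)\<^sup>*}"
  proof (intro set_eqI iffI)
    fix u assume "u \<in> ray_component H r"
    then obtain N where u: "u \<in> verts H" "\<forall>j\<ge>N. (u, r j) \<in> (adj H)\<^sup>*"
      unfolding ray_component_def by blast
    have "(u, r (max N n)) \<in> (adj H)\<^sup>*" "(r (max N n), r i) \<in> (adj H)\<^sup>*"
      using u(2) ray_reach[OF assms(1), of "max N n" i] assms(2) by auto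
    then show "u \<in> {u \<in> verts H. (r i, u) \<in> (adj H)\<^sup>*}"
      using u(1) by (blast intro: reach_sym rtrancl_trans)
  next
    fix u assume u: "u \<in> {u \<in> verts H. (r i, u) \<in> (adj H)\<^sup>*}"
    have "(u, r j) \<in> (adj H)\<^sup>*" if "n \<le> j" for j
      using u ray_reach[OF assms(1) assms(2) that] by (blast intro: reach_sym rtrancl_trans)
    then show "u \<in> ray_component H r" using u unfolding ray_component_def by blast
  qed
  show "r i \<in> verts H"
    using assms unfolding is_ray_def ray_tail_def
    by (metis le_add_diff_inverse rangeI subsetD)
qed

lemma ray_component_in_components:
  assumes "is_ray H (ray_tail n r)"
  shows "ray_component H r \<in> graph_components H"
  using ray_component_eq[OF assms order_refl] unfolding graph_components_def by blast

lemma components_disjoint: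
  assumes "C \<in> graph_components H" "D \<in> graph_components H" "u \<in> C" "u \<in> D"
  shows "C = D"
proof -
  have *: "E = {w \<in> verts H. (u, w) \<in> (adj H)\<^sup>*}" if E: "E \<in> graph_components H" "u \<in> E" for E
  proof -
    obtain v where v: "E = {w \<in> verts H. (v, w) \<in> (adj H)\<^sup>*}"
      using E(1) unfolding graph_components_def by blast
    then have "(v, u) \<in> (adj H)\<^sup>*" "(u, v) \<in> (adj H)\<^sup>*" using E(2) reach_sym by auto
    then show ?thesis unfolding v by (blast intro: rtrancl_trans)
  qed
  show ?thesis using *[of C] *[of D] assms by simp
qed

lemma has_tail_in_component_iff:
  assumes "is_ray H (ray_tail n r)" "C \<in> graph_components H"
  shows "has_tail_in_component H C r \<longleftrightarrow> C = ray_component H r"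
proof
  assume "has_tail_in_component H C r"
  then obtain m where m: "is_ray H (ray_tail m r)" "range (ray_tail m r) \<subseteq> C"
    unfolding has_tail_in_component_def by blast
  have "r m \<in> C" using m(2) unfolding ray_tail_def by (metis add.right_neutral rangeI subsetD)
  moreover have "r m \<in> ray_component H r" using ray_component_eq[OF m(1), of m] by simp
  ultimately show "C = ray_component H r"
    using components_disjoint ray_component_in_components assms by metis
next
  assume "C = ray_component H r"
  moreover have "r (n + i) \<in> ray_component H r" for i
    using ray_component_eq[OF assms(1), of "n + i"] by simp
  ultimately have "range (ray_tail n r) \<subseteq> C" by (auto simp: ray_tail_def)
  with assms(1) show "has_tail_in_component H C r"
    unfolding has_tail_in_component_def by blast
qed

lemma same_tail_component_iff:
  assumes "is_ray H (ray_tail n r)" "is_ray H (ray_tail m s)"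
  shows "(\<exists>C\<in>graph_components H. has_tail_in_component H C r \<and> has_tail_in_component H C s)
    \<longleftrightarrow> ray_component H r = ray_component H s"
  using has_tail_in_component_iff[OF assms(1)] has_tail_in_component_iff[OF assms(2)]
    ray_component_in_components[OF assms(1)] by auto

lemma is_ray_tail_delete_verts:
  assumes "is_ray G r" "finite X"
  shows "\<exists>n. is_ray (delete_verts G X) (ray_tail n r)"
proof -
  have "finite (r -` X)"
    using assms unfolding is_ray_def by (auto intro: finite_vimageI)
  then obtain n where n: "\<And>i. r i \<in> X \<Longrightarrow> i < n"
    unfolding finite_nat_set_iff_bounded by blast
  have "r (n + i) \<notin> X" for i using n[of "n + i"] by auto
  moreover have "r (Suc (n + i)) \<notin> X" for i using n[of "Suc (n + i)"] by auto
  ultimately have "is_ray (delete_verts G X) (ray_tail n r)"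
    using assms(1) unfolding is_ray_def ray_tail_def delete_verts_def
    by (auto intro!: injI simp: inj_eq)
  then show ?thesis ..
qed

lemma is_ray_tail_delete_edges:
  assumes "is_ray G r" "finite F"
  shows "\<exists>n. is_ray (delete_edges G F) (ray_tail n r)"
proof -
  have "inj (\<lambda>i. {r i, r (Suc i)})"
    using assms(1) unfolding is_ray_def by (auto intro!: injI simp: doubleton_eq_iff inj_eq)
  then have "finite ((\<lambda>i. {r i, r (Suc i)}) -` F)"
    using assms(2) by (auto intro: finite_vimageI)
  then obtain n where n: "\<And>i. {r i, r (Suc i)} \<in> F \<Longrightarrow> i < n"
    unfolding finite_nat_set_iff_bounded by blast
  have "{r (n + i), r (Suc (n + i))} \<notin> F" for i using n[of "n + i"] by auto
  then have "is_ray (delete_edges G F) (ray_tail n r)"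
    using assms(1) unfolding is_ray_def ray_tail_def delete_edges_def
    by (auto intro!: injI simp: inj_eq)
  then show ?thesis ..
qed

lemma ray_equiv_iff:
  "(r, s) \<in> ray_equiv G \<longleftrightarrow> is_ray G r \<and> is_ray G s \<and>
     (\<forall>X. finite X \<and> X \<subseteq> verts G \<longrightarrow>
        ray_component (delete_verts G X) r = ray_component (delete_verts G X) s)"
proof -
  have "(\<exists>C\<in>graph_components (delete_verts G X). has_tail_in_component (delete_verts G X) C r \<and>
      has_tail_in_component (delete_verts G X) C s) \<longleftrightarrow>
      ray_component (delete_verts G X) r = ray_component (delete_verts G X) s"
    if "is_ray G r" "is_ray G s" "finite X" for X
    using that is_ray_tail_delete_verts same_tail_component_iff by metis
  then show ?thesis unfolding ray_equiv_def by auto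
qed

lemma ray_edge_equiv_iff:
  "(r, s) \<in> ray_edge_equiv G \<longleftrightarrow> is_ray G r \<and> is_ray G s \<and>
     (\<forall>F. finite F \<and> F \<subseteq> edges G \<longrightarrow>
        ray_component (delete_edges G F) r = ray_component (delete_edges G F) s)"
proof -
  have "(\<exists>C\<in>graph_components (delete_edges G X). has_tail_in_component (delete_edges G X) C r \<and>
      has_tail_in_component (delete_edges G X) C s) \<longleftrightarrow>
      ray_component (delete_edges G X) r = ray_component (delete_edges G X) s"
    if "is_ray G r" "is_ray G s" "finite X" for X
    using that is_ray_tail_delete_edges same_tail_component_iff by metis
  then show ?thesis unfolding ray_edge_equiv_def by auto
qed

lemma equiv_ray_equiv: "equiv {r. is_ray G r} (ray_equiv G)"
  by (rule equivI) (auto simp: refl_on_def sym_def trans_def ray_equiv_iff)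

lemma equiv_ray_edge_equiv: "equiv {r. is_ray G r} (ray_edge_equiv G)"
  by (rule equivI) (auto simp: refl_on_def sym_def trans_def ray_edge_equiv_iff)

lemma ray_component_in_components_delete_verts:
  assumes "is_ray G r" "finite X"
  shows "ray_component (delete_verts G X) r \<in> graph_components (delete_verts G X)"
  using is_ray_tail_delete_verts[OF assms] ray_component_in_components by blast

lemma ray_eventually_in_component:
  assumes "is_ray G r" "finite X"
  shows "\<exists>N. \<forall>i\<ge>N. r i \<in> ray_component (delete_verts G X) r"
proof -
  obtain n where n: "is_ray (delete_verts G X) (ray_tail n r)"
    using is_ray_tail_delete_verts[OF assms] by blast
  have "r i \<in> ray_component (delete_verts G X) r" if "n \<le> i" for i
    using ray_component_eq[OF n that] by auto
  then show ?thesis by blast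
qed

lemma in_ray_component_edges_iff:
  assumes "is_ray G r" "finite F" "x \<in> verts G"
  shows "x \<in> ray_component (delete_edges G F) r \<longleftrightarrow>
    (\<forall>N. \<exists>i\<ge>N. (x, r i) \<in> (adj (delete_edges G F))\<^sup>*)" (is "?L \<longleftrightarrow> ?R")
proof
  assume ?L
  then obtain N where "\<forall>i\<ge>N. (x, r i) \<in> (adj (delete_edges G F))\<^sup>*"
    unfolding ray_component_def by blast
  then show ?R by (meson max.cobounded1 max.cobounded2)
next
  assume R: ?R
  obtain n where n: "is_ray (delete_edges G F) (ray_tail n r)"
    using is_ray_tail_delete_edges[OF assms(1,2)] by blast
  obtain i where i: "i \<ge> n" "(x, r i) \<in> (adj (delete_edges G F))\<^sup>*" using R by blast
  then show ?L unfolding ray_component_eq(1)[OF n i(1)] using assms(3) reach_sym[OF i(2)] by simp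
qed

lemma adj_delete_mono:
  "F \<subseteq> F' \<Longrightarrow> adj (delete_edges G F') \<subseteq> adj (delete_edges G F)"
  "X \<subseteq> X' \<Longrightarrow> adj (delete_verts G X') \<subseteq> adj (delete_verts G X)"
  "adj (delete_verts G (\<Union>F)) \<subseteq> adj (delete_edges G F)"
  by (auto simp: adj_delete_edges adj_delete_verts)

lemma ray_component_mono:
  assumes "adj H \<subseteq> adj H'" "verts H \<subseteq> verts H'"
  shows "ray_component H r \<subseteq> ray_component H' r"
  using rtrancl_mono[OF assms(1)] assms(2) unfolding ray_component_def by blast

text \<open>
  The ends of finitely many edges form a finite set of vertices, and deleting that set disconnects at
  least as much as deleting the edges.
\<close>
lemma ray_equiv_imp_edge_equiv:
  assumes G: "is_graph G" and rs: "(r, s) \<in> ray_equiv G"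
  shows "(r, s) \<in> ray_edge_equiv G"
  unfolding ray_edge_equiv_iff
proof (intro conjI allI impI)
  show r: "is_ray G r" and s: "is_ray G s" using rs by (auto simp: ray_equiv_iff)
  fix F assume F: "finite F \<and> F \<subseteq> edges G"
  have "finite e" if "e \<in> F" for e
    using that F G unfolding is_graph_def by (metis card.infinite subsetD zero_neq_numeral)
  then have X: "finite (\<Union>F)" "\<Union>F \<subseteq> verts G"
    using F G unfolding is_graph_def by blast+
  let ?H = "delete_verts G (\<Union>F)"
  obtain N where "\<forall>i\<ge>N. r i \<in> ray_component ?H r"
    using ray_eventually_in_component[OF r X(1)] by blast
  then have "r N \<in> ray_component ?H r" "r N \<in> ray_component ?H s"
    using rs X unfolding ray_equiv_iff by auto
  moreover have "ray_component ?H t \<subseteq> ray_component (delete_edges G F) t" for t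
    by (rule ray_component_mono) (use adj_delete_mono(3) in auto)
  ultimately have N: "r N \<in> ray_component (delete_edges G F) r" "r N \<in> ray_component (delete_edges G F) s"
    by blast+
  obtain n where n: "is_ray (delete_edges G F) (ray_tail n r)"
    using is_ray_tail_delete_edges r F by blast
  obtain m where m: "is_ray (delete_edges G F) (ray_tail m s)"
    using is_ray_tail_delete_edges s F by blast
  show "ray_component (delete_edges G F) r = ray_component (delete_edges G F) s"
    by (rule components_disjoint[OF _ _ N]) (rule ray_component_in_components, fact n m)+
qed

lemma reach_Restr_closed:
  assumes "(u, v) \<in> R\<^sup>*" "u \<in> S" "\<And>a b. a \<in> S \<Longrightarrow> (a, b) \<in> R \<Longrightarrow> b \<in> S"
  shows "(u, v) \<in> (Restr R S)\<^sup>* \<and> v \<in> S"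
  using assms(1)
proof (induction rule: rtrancl_induct)
  case (step y z)
  then have "(y, z) \<in> Restr R S" using assms(3) by blast
  then show ?case using step by (auto intro: rtrancl_into_rtrancl)
qed (use assms(2) in simp)

lemma component_connected:
  assumes "C \<in> graph_components H" "is_graph H" "u \<in> C" "w \<in> C"
  shows "(u, w) \<in> (Restr (adj H) C)\<^sup>*"
proof -
  obtain v where C: "C = {w \<in> verts H. (v, w) \<in> (adj H)\<^sup>*}"
    using assms(1) unfolding graph_components_def by blast
  have "(u, w) \<in> (adj H)\<^sup>*" using assms(3,4) unfolding C by (blast intro: reach_sym rtrancl_trans)
  moreover have "b \<in> C" if "a \<in> C" "(a, b) \<in> adj H" for a b
    using that assms(2) unfolding C is_graph_def adj_iff
    by (auto simp: adj_iff intro: rtrancl_into_rtrancl)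
  ultimately show ?thesis using reach_Restr_closed assms(3) by metis
qed

lemma is_graph_delete:
  assumes "is_graph G" shows "is_graph (delete_verts G X)" "is_graph (delete_edges G F)"
  using assms unfolding is_graph_def delete_verts_def delete_edges_def by auto

lemma component_connected_delete_verts:
  assumes "is_graph G" "C \<in> graph_components (delete_verts G X)" "u \<in> C" "w \<in> C"
  shows "(u, w) \<in> (Restr (adj G) C)\<^sup>*"
proof -
  have "(u, w) \<in> (Restr (adj (delete_verts G X)) C)\<^sup>*"
    using component_connected[OF assms(2) is_graph_delete(1)[OF assms(1)] assms(3,4)] .
  moreover have "Restr (adj (delete_verts G X)) C \<subseteq> Restr (adj G) C"
    by (auto simp: adj_delete_verts adj_iff[of _ _ G])
  ultimately show ?thesis using rtrancl_mono by blast
qed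

section \<open>Domination\<close>

text \<open>
  A finite set without \<open>v\<close> meets only finitely many paths of a fan at \<open>v\<close>. Conversely, a fan is built
  greedily, each new path avoiding the vertices of the earlier ones except \<open>v\<close>.
\<close>
lemma dominates_iff:
  assumes G: "is_graph G" and r: "is_ray G r" and v: "v \<in> verts G"
  shows "dominates G v r \<longleftrightarrow>
    (\<forall>Z. finite Z \<and> Z \<subseteq> verts G - {v} \<longrightarrow> v \<in> ray_component (delete_verts G Z) r)"
proof
  assume "dominates G v r"
  then obtain P where P: "infinite P"
      "\<forall>p\<in>P. is_path G p \<and> hd p = v \<and> last p \<in> range r"
      "\<forall>p\<in>P. \<forall>q\<in>P. p \<noteq> q \<longrightarrow> set p \<inter> set q = {v}"
    unfolding dominates_def by (elim exE conjE)
  show "\<forall>Z. finite Z \<and> Z \<subseteq> verts G - {v} \<longrightarrow> v \<in> ray_component (delete_verts G Z) r"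
  proof (intro allI impI)
    fix Z assume Z: "finite Z \<and> Z \<subseteq> verts G - {v}"
    obtain n where n: "is_ray (delete_verts G Z) (ray_tail n r)"
      using is_ray_tail_delete_verts[OF r] Z by blast
    let ?Z = "Z \<union> (r ` {..<n} - {v})"
    \<comment> \<open>Two paths of the family meet in \<open>v\<close> only, so a vertex of the finite set \<open>?Z\<close> blocks at most
      one of them.\<close>
    define Q where "Q = {p \<in> P. set p \<inter> ?Z \<noteq> {}}"
    have "\<forall>p\<in>Q. \<exists>z. z \<in> set p \<inter> ?Z" unfolding Q_def by blast
    from bchoice[OF this] obtain h where h: "\<forall>p\<in>Q. h p \<in> set p \<inter> ?Z" by (rule exE)
    have "v \<notin> ?Z" using Z by auto
    have "inj_on h Q"
    proof (rule inj_onI)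
      fix p q assume pq: "p \<in> Q" "q \<in> Q" "h p = h q"
      then have "h p \<in> set p \<inter> set q" "h p \<noteq> v" using h \<open>v \<notin> ?Z\<close> by auto
      then show "p = q" using P(3) pq(1,2) unfolding Q_def by blast
    qed
    moreover have "h ` Q \<subseteq> ?Z" using h by blast
    moreover have "finite ?Z" using Z by auto
    ultimately have "finite Q" by (metis finite_imageD finite_subset)
    then have "infinite (P - insert [v] Q)" using P(1) by simp
    then obtain p where "p \<in> P - insert [v] Q" by (metis ex_in_conv finite.emptyI)
    then have p: "p \<in> P" "p \<noteq> [v]" "set p \<inter> ?Z = {}" unfolding Q_def by auto
    obtain i where i: "last p = r i" using bspec[OF P(2) p(1)] by blast
    have pp: "is_path G p" "hd p = v" using bspec[OF P(2) p(1)] by auto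
    have "last p \<noteq> v"
    proof
      assume "last p = v"
      moreover obtain ys where "p = v # ys" using pp unfolding is_path_def by (cases p) auto
      ultimately show False using p(2) pp(1) last_in_set[of ys] unfolding is_path_def
        by (auto split: if_splits)
    qed
    moreover have "last p \<in> set p" using pp unfolding is_path_def by simp
    ultimately have "n \<le> i" using p(3) i by (metis DiffI Int_iff UnI2 empty_iff imageI
          lessThan_iff linorder_not_less singletonD)
    have "(v, r i) \<in> (Restr (adj G) (set p))\<^sup>*" using path_reach[OF pp(1) subset_refl] pp i by simp
    moreover have "Restr (adj G) (set p) \<subseteq> adj (delete_verts G Z)"
      using p(3) by (auto simp: adj_delete_verts adj_iff[of _ _ G])
    ultimately have "(v, r i) \<in> (adj (delete_verts G Z))\<^sup>*" using rtrancl_mono by blast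
    then show "v \<in> ray_component (delete_verts G Z) r"
      using ray_component_eq[OF n \<open>n \<le> i\<close>] v Z reach_sym by auto
  qed
next
  assume *: "\<forall>Z. finite Z \<and> Z \<subseteq> verts G - {v} \<longrightarrow> v \<in> ray_component (delete_verts G Z) r"
  \<comment> \<open>The set \<open>Z\<close> collects the vertices other than \<open>v\<close> of the paths chosen so far.\<close>
  define ok where "ok = (\<lambda>(p, Z). finite Z \<and> Z \<subseteq> verts G - {v} \<and> set p \<subseteq> insert v Z \<and>
    is_path G p \<and> hd p = v \<and> last p \<in> range r)"
  define nxt where "nxt = (\<lambda>(p::'a list, Z::'a set) (q, Z').
    Z \<subseteq> Z' \<and> set q \<inter> Z = {} \<and> last q \<noteq> v)"
  have step: "\<exists>y. ok y \<and> nxt x y" if Zx: "finite (snd x)" "snd x \<subseteq> verts G - {v}" for x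
  proof -
    obtain p Z where x: "x = (p, Z)" by fastforce
    then have Z: "finite Z" "Z \<subseteq> verts G - {v}" using Zx by auto
    then have "v \<in> ray_component (delete_verts G Z) r" using * by blast
    then obtain N where N: "\<And>i. i \<ge> N \<Longrightarrow> (v, r i) \<in> (adj (delete_verts G Z))\<^sup>*"
      unfolding ray_component_def by blast
    have "finite (r -` {v})" using r unfolding is_ray_def by (auto intro: finite_vimageI)
    then obtain i where i: "i \<ge> N" "r i \<noteq> v"
      by (metis finite_nat_set_iff_bounded insertI1 linorder_not_less nat_le_linear vimage_eq)
    have "a \<in> verts G - Z \<Longrightarrow> (a, b) \<in> adj (delete_verts G Z) \<Longrightarrow> b \<in> verts G - Z" for a b
      using G unfolding is_graph_def adj_delete_verts by auto
    then have "(v, r i) \<in> (Restr (adj (delete_verts G Z)) (verts G - Z))\<^sup>*"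
      using reach_Restr_closed[OF N[OF i(1)], of "verts G - Z"] v Z by blast
    moreover have "Restr (adj (delete_verts G Z)) (verts G - Z) \<subseteq> Restr (adj G) (verts G - Z)"
      by (auto simp: adj_delete_verts adj_iff[of _ _ G])
    ultimately have "(v, r i) \<in> (Restr (adj G) (verts G - Z))\<^sup>*" using rtrancl_mono by blast
    then obtain q where "is_path G q" "hd q = v" "last q = r i" "set q \<subseteq> verts G - Z"
      using path_within[of v "r i" G "verts G - Z"] v Z by blast
    then have "ok (q, Z \<union> (set q - {v})) \<and> nxt x (q, Z \<union> (set q - {v}))"
      using Z i unfolding ok_def nxt_def x by auto
    then show ?thesis by blast
  qed
  have "\<exists>f. \<forall>n. ok (f n) \<and> nxt (f n) (f (Suc n))"
  proof (rule dependent_nat_choice[of "\<lambda>_. ok" "\<lambda>_. nxt"])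
    show "\<exists>x. ok x" using step[of "([], {})"] by auto
    show "\<exists>y. ok y \<and> nxt x y" if "ok x" for x n
      using step[of x] that unfolding ok_def by auto
  qed
  then obtain f where f: "\<And>n. ok (f n)" "\<And>n. nxt (f n) (f (Suc n))" by blast
  define p where "p n = fst (f (Suc n))" for n
  define Z where "Z n = snd (f (Suc n))" for n
  have p: "is_path G (p n)" "hd (p n) = v" "last (p n) \<in> range r" "set (p n) \<subseteq> insert v (Z n)"
    "last (p n) \<noteq> v" "Z n \<subseteq> Z (Suc n)" "set (p (Suc n)) \<inter> Z n = {}" for n
    using f(1)[of "Suc n"] f(2)[of n] f(2)[of "Suc n"]
    unfolding ok_def nxt_def p_def Z_def by (auto split: prod.splits)
  have mem: "v \<in> set (p n)" "last (p n) \<in> set (p n)" for n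
    using p(1)[of n] hd_in_set[of "p n"] unfolding p(2)[of n] is_path_def by simp_all
  have disj: "set (p m) \<inter> set (p n) \<subseteq> {v}" if mn: "m < n" for m n
  proof -
    obtain k where k: "n = Suc k" "m \<le> k" using mn by (cases n) auto
    have "Z m \<subseteq> Z k" using k(2) by (induction rule: dec_induct) (use p(6) in auto)
    then show ?thesis using p(4)[of m] p(7)[of k] k(1) by blast
  qed
  have disj': "set (p m) \<inter> set (p n) = {v}" if "m \<noteq> n" for m n
    using disj[of m n] disj[of n m] mem that by (cases m n rule: linorder_cases) auto
  have "inj p"
  proof (rule injI, rule ccontr)
    fix m n assume "p m = p n" "m \<noteq> n"
    then have "last (p m) \<in> set (p m) \<inter> set (p n)" using mem(2)[of m] by simp
    then show False using disj'[OF \<open>m \<noteq> n\<close>] p(5)[of m] by blast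
  qed
  then have "infinite (range p)" by (rule range_inj_infinite)
  moreover have "set q \<inter> set q' = {v}" if "q \<in> range p" "q' \<in> range p" "q \<noteq> q'" for q q'
    using that disj' by (elim rangeE) metis
  ultimately show "dominates G v r"
    unfolding dominates_def using p(1-3) by (intro exI[of _ "range p"] conjI ballI impI) auto
qed

lemma nondominated_ray_equiv:
  assumes "is_graph G" "(r, s) \<in> ray_equiv G"
  shows "nondominated G r \<longleftrightarrow> nondominated G s"
proof -
  have "dominates G v r \<longleftrightarrow> dominates G v s" if "v \<in> verts G" for v
    using assms(2) dominates_iff[OF assms(1) _ that] unfolding ray_equiv_iff
    by (metis Diff_subset subset_trans)
  then show ?thesis unfolding nondominated_def by blast
qed

section \<open>Bases of ends\<close>

definition closed_nbhd :: "'a ugraph \<Rightarrow> 'a set \<Rightarrow> 'a set" where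
  "closed_nbhd G C = C \<union> {x. \<exists>c\<in>C. {x, c} \<in> edges G}"

text \<open>
  Requiring every vertex to leave even the closed neighbourhoods, not just the sets \<open>C n\<close>, is what
  makes the end non-dominated: a vertex that dominates the end lies in the closed neighbourhood of
  every \<open>C n\<close>.
\<close>
definition end_basis :: "'a ugraph \<Rightarrow> (nat \<Rightarrow> 'a set) \<Rightarrow> bool" where
  "end_basis G C \<longleftrightarrow> decseq C \<and>
     (\<forall>n. \<exists>X. finite X \<and> X \<subseteq> verts G \<and> C n \<in> graph_components (delete_verts G X)) \<and>
     (\<forall>x\<in>verts G. \<exists>n. x \<notin> closed_nbhd G (C n))"

definition ray_follows :: "(nat \<Rightarrow> 'a set) \<Rightarrow> (nat \<Rightarrow> 'a) \<Rightarrow> bool" where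
  "ray_follows C r \<longleftrightarrow> (\<forall>n. \<exists>N. \<forall>i\<ge>N. r i \<in> C n)"

lemma closed_nbhd_mono: "C \<subseteq> D \<Longrightarrow> closed_nbhd G C \<subseteq> closed_nbhd G D"
  unfolding closed_nbhd_def by blast

lemma subset_closed_nbhd: "C \<subseteq> closed_nbhd G C"
  unfolding closed_nbhd_def by blast

lemma component_subset: "C \<in> graph_components H \<Longrightarrow> C \<subseteq> verts H"
  unfolding graph_components_def by blast

lemma component_nonempty: "C \<in> graph_components H \<Longrightarrow> C \<noteq> {}"
  unfolding graph_components_def by blast

lemma component_closed:
  assumes "C \<in> graph_components H" "u \<in> C" "(u, w) \<in> (adj H)\<^sup>*" "w \<in> verts H"
  shows "w \<in> C"
proof -
  obtain v where C: "C = {w \<in> verts H. (v, w) \<in> (adj H)\<^sup>*}"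
    using assms(1) unfolding graph_components_def by blast
  show ?thesis using assms unfolding C by (auto intro: rtrancl_trans)
qed

lemma component_edge_closed:
  assumes "is_graph G" "C \<in> graph_components (delete_verts G X)" "c \<in> C" "{x, c} \<in> edges G" "x \<notin> X"
  shows "x \<in> C"
proof -
  have "c \<notin> X" using component_subset[OF assms(2)] assms(3) by auto
  then have "(c, x) \<in> adj (delete_verts G X)" using assms by (simp add: adj_delete_verts insert_commute)
  moreover have "x \<in> verts G - X" using assms unfolding is_graph_def by blast
  ultimately show ?thesis using component_closed[OF assms(2,3), of x] by auto
qed

lemma boundary_subset:
  assumes "is_graph G" "C \<in> graph_components (delete_verts G X)"
  shows "closed_nbhd G C - C \<subseteq> X"
  using component_edge_closed[OF assms] unfolding closed_nbhd_def by blast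

context
  fixes G :: "'a ugraph" and C :: "nat \<Rightarrow> 'a set"
  assumes G: "is_graph G" and C: "end_basis G C"
begin

lemma end_basis_decseq: "m \<le> n \<Longrightarrow> C n \<subseteq> C m"
  using C unfolding end_basis_def by (simp add: decseq_def)

lemma end_basis_component:
  obtains X where "finite X" "X \<subseteq> verts G" "C n \<in> graph_components (delete_verts G X)"
  using C unfolding end_basis_def by blast

lemma end_basis_subset: "C n \<subseteq> verts G"
  by (rule end_basis_component[of n]) (use component_subset in force)

lemma end_basis_nonempty: "C n \<noteq> {}"
  by (rule end_basis_component[of n]) (rule component_nonempty)

lemma finite_boundary: "finite (closed_nbhd G (C n) - C n)"
  by (rule end_basis_component[of n]) (rule finite_subset[OF boundary_subset[OF G]])

lemma end_basis_vertex: "\<exists>n. x \<notin> closed_nbhd G (C n)"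
proof (cases "x \<in> verts G")
  case False
  then have "x \<notin> closed_nbhd G (C 0)"
    using end_basis_subset[of 0] G unfolding closed_nbhd_def is_graph_def by blast
  then show ?thesis ..
qed (use C in \<open>simp add: end_basis_def\<close>)

lemma end_basis_avoids:
  assumes "finite Z"
  shows "\<exists>n. \<forall>m\<ge>n. closed_nbhd G (C m) \<inter> Z = {}"
  using assms
proof (induction Z)
  case (insert z Z)
  then obtain n where n: "\<forall>m\<ge>n. closed_nbhd G (C m) \<inter> Z = {}" by blast
  obtain k where k: "z \<notin> closed_nbhd G (C k)" using end_basis_vertex by blast
  have "closed_nbhd G (C m) \<inter> insert z Z = {}" if "max n k \<le> m" for m
    using n k that closed_nbhd_mono[OF end_basis_decseq[of k m], of G] by auto
  then show ?case by blast
qed simp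

lemma end_basis_connected:
  assumes "u \<in> C n" "w \<in> C n"
  shows "(u, w) \<in> (Restr (adj G) (C n))\<^sup>*"
  by (rule end_basis_component[of n]) (rule component_connected_delete_verts[OF G _ assms])

text \<open>
  A late \<open>C n\<close> avoids a given finite set \<open>X\<close> and is connected, so rays with tails in it have tails in
  the same component of \<open>G - X\<close>. Conversely, \<open>C n\<close> is itself a component after a finite deletion, and
  equivalent rays have tails in the same one.
\<close>
lemma ray_follows_equiv_iff:
  assumes r: "is_ray G r" and s: "is_ray G s" and follows: "ray_follows C r"
  shows "ray_follows C s \<longleftrightarrow> (r, s) \<in> ray_equiv G"
proof
  assume s': "ray_follows C s"
  have "ray_component (delete_verts G X) r = ray_component (delete_verts G X) s"
    if X: "finite X" for X
  proof -
    obtain n where "closed_nbhd G (C n) \<inter> X = {}" using end_basis_avoids[OF X] by blast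
    then have n: "C n \<inter> X = {}" using subset_closed_nbhd[of "C n" G] by blast
    obtain N1 where N1: "\<forall>i\<ge>N1. r i \<in> C n" using follows unfolding ray_follows_def by blast
    obtain N2 where N2: "\<forall>i\<ge>N2. s i \<in> C n" using s' unfolding ray_follows_def by blast
    obtain N3 where N3: "\<forall>i\<ge>N3. r i \<in> ray_component (delete_verts G X) r"
      using ray_eventually_in_component[OF r X] by blast
    obtain N4 where N4: "\<forall>i\<ge>N4. s i \<in> ray_component (delete_verts G X) s"
      using ray_eventually_in_component[OF s X] by blast
    define i where "i = N1 + N2 + N3 + N4"
    have i: "r i \<in> C n" "s i \<in> C n" "r i \<in> ray_component (delete_verts G X) r"
      "s i \<in> ray_component (delete_verts G X) s"
      using N1 N2 N3 N4 by (auto simp: i_def)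
    have "Restr (adj G) (C n) \<subseteq> adj (delete_verts G X)"
      using n by (auto simp: adj_delete_verts adj_iff[of _ _ G])
    then have "(r i, s i) \<in> (adj (delete_verts G X))\<^sup>*"
      using end_basis_connected[OF i(1,2)] rtrancl_mono by blast
    moreover have "s i \<in> verts (delete_verts G X)"
      using i(4) unfolding ray_component_def by blast
    ultimately have "s i \<in> ray_component (delete_verts G X) r"
      using component_closed[OF ray_component_in_components_delete_verts[OF r X] i(3)] by blast
    then show ?thesis
      using components_disjoint[OF ray_component_in_components_delete_verts[OF r X]
        ray_component_in_components_delete_verts[OF s X] _ i(4)] by simp
  qed
  then show "(r, s) \<in> ray_equiv G" unfolding ray_equiv_iff using r s by blast
next
  assume rs: "(r, s) \<in> ray_equiv G"
  show "ray_follows C s"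
    unfolding ray_follows_def
  proof
    fix n
    obtain X where X: "finite X" "X \<subseteq> verts G" "C n \<in> graph_components (delete_verts G X)"
      by (rule end_basis_component)
    obtain N where N: "\<forall>i\<ge>N. r i \<in> C n" using follows unfolding ray_follows_def by blast
    obtain M where M: "\<forall>i\<ge>M. r i \<in> ray_component (delete_verts G X) r"
      using ray_eventually_in_component[OF r X(1)] by blast
    have "r (N + M) \<in> C n" "r (N + M) \<in> ray_component (delete_verts G X) r"
      using N M by auto
    then have "C n = ray_component (delete_verts G X) r"
      using components_disjoint[OF X(3) ray_component_in_components_delete_verts[OF r X(1)]] by blast
    also have "\<dots> = ray_component (delete_verts G X) s" using rs X unfolding ray_equiv_iff by blast
    finally show "\<exists>N. \<forall>i\<ge>N. s i \<in> C n" using ray_eventually_in_component[OF s X(1)] by simp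
  qed
qed

text \<open>
  Suppose that \<open>v\<close> dominates \<open>r\<close>, choose \<open>C n\<close> without \<open>v\<close> and without neighbours of \<open>v\<close>, and
  delete the finite boundary of \<open>C n\<close>: since it does not contain \<open>v\<close>, this does not separate \<open>v\<close>
  from \<open>r\<close>.
\<close>
lemma ray_follows_nondominated:
  assumes r: "is_ray G r" and follows: "ray_follows C r"
  shows "nondominated G r"
  unfolding nondominated_def
proof
  assume "\<exists>v\<in>verts G. dominates G v r"
  then obtain v where v: "v \<in> verts G" "dominates G v r" by blast
  obtain n where n: "v \<notin> closed_nbhd G (C n)" using end_basis_vertex by blast
  let ?Z = "closed_nbhd G (C n) - C n"
  have "?Z \<subseteq> verts G" using G unfolding closed_nbhd_def is_graph_def by blast
  then have Z: "finite ?Z" "?Z \<subseteq> verts G - {v}" using finite_boundary n by auto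
  then have "v \<in> ray_component (delete_verts G ?Z) r"
    using dominates_iff[OF G r v(1)] v(2) by blast
  then obtain N where N: "\<forall>i\<ge>N. (v, r i) \<in> (adj (delete_verts G ?Z))\<^sup>*"
    unfolding ray_component_def by blast
  obtain M where M: "\<forall>i\<ge>M. r i \<in> C n" using follows unfolding ray_follows_def by blast
  have "(r (N + M), v) \<in> (adj (delete_verts G ?Z))\<^sup>*" using N by (auto intro!: reach_sym[of v])
  moreover have "b \<in> C n" if "a \<in> C n" "(a, b) \<in> adj (delete_verts G ?Z)" for a b
  proof -
    have "{b, a} \<in> edges G" "b \<notin> ?Z" using that(2) by (simp_all add: adj_delete_verts insert_commute)
    then show ?thesis using that(1) unfolding closed_nbhd_def by blast
  qed
  moreover have "r (N + M) \<in> C n" using M by auto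
  ultimately have "v \<in> C n" using reach_Restr_closed[of "r (N + M)" v _ "C n"] by blast
  then show False using n subset_closed_nbhd[of "C n" G] by blast
qed

end

text \<open>
  Every vertex \<open>x\<close> is separated from the tails of a non-dominated ray by a finite set \<open>Z x\<close> of other
  vertices. Adding to a finite set \<open>X\<close> the sets \<open>Z x\<close> with \<open>x \<in> X\<close> moves the component that contains
  a tail away from its old boundary, so that a vertex at distance \<open>d\<close> from \<open>r 0\<close> is outside after
  \<open>d\<close> rounds, and its neighbours are outside after one more round.
\<close>
lemma nondominated_has_end_basis:
  assumes G: "is_graph G" and r: "is_ray G r" and nd: "nondominated G r"
  obtains C where "end_basis G C" "ray_follows C r"
proof -
  have "\<exists>Z. finite Z \<and> Z \<subseteq> verts G - {x} \<and> x \<notin> ray_component (delete_verts G Z) r"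
    if "x \<in> verts G" for x
    using nd dominates_iff[OF G r that] that unfolding nondominated_def by blast
  then obtain Z where Z: "\<And>x. x \<in> verts G \<Longrightarrow> finite (Z x) \<and> Z x \<subseteq> verts G - {x} \<and>
      x \<notin> ray_component (delete_verts G (Z x)) r"
    by metis
  define X where "X = rec_nat {r 0} (\<lambda>_ Y. Y \<union> (\<Union>x\<in>Y. Z x))"
  have X0: "X 0 = {r 0}" and XS: "X (Suc n) = X n \<union> (\<Union>x\<in>X n. Z x)" for n
    by (simp_all add: X_def)
  have r_verts: "r i \<in> verts G" for i using r unfolding is_ray_def by blast
  have X: "finite (X n) \<and> X n \<subseteq> verts G" for n
    by (induction n) (use Z r_verts in \<open>auto simp: X0 XS\<close>)
  define C where "C n = ray_component (delete_verts G (X n)) r" for n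
  have comp: "C n \<in> graph_components (delete_verts G (X n))" for n
    unfolding C_def using ray_component_in_components_delete_verts[OF r] X by blast
  have dec: "C (Suc n) \<subseteq> C n" for n
    unfolding C_def by (rule ray_component_mono) (use adj_delete_mono(2)[of "X n" "X (Suc n)" G] in \<open>auto simp: XS\<close>)
  have nbhd: "closed_nbhd G (C (Suc n)) \<subseteq> C n" for n
  proof
    fix y assume "y \<in> closed_nbhd G (C (Suc n))"
    then consider "y \<in> C (Suc n)" | c where "c \<in> C (Suc n)" "{y, c} \<in> edges G"
      unfolding closed_nbhd_def by blast
    then show "y \<in> C n"
    proof cases
      case 2
      show ?thesis
      proof (rule ccontr)
        assume "y \<notin> C n"
        then have y: "y \<in> X n"
          using component_edge_closed[OF G comp, of c n y] 2 dec by blast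
        then have yG: "y \<in> verts G" using X by blast
        have "Z y \<subseteq> X (Suc n)" using y by (auto simp: XS)
        then have "C (Suc n) \<subseteq> ray_component (delete_verts G (Z y)) r"
          unfolding C_def by (intro ray_component_mono adj_delete_mono) auto
        then have "c \<in> ray_component (delete_verts G (Z y)) r" using 2 by blast
        moreover have "ray_component (delete_verts G (Z y)) r
            \<in> graph_components (delete_verts G (Z y))"
          using ray_component_in_components_delete_verts[OF r] Z[OF yG] by blast
        ultimately have "y \<in> ray_component (delete_verts G (Z y)) r"
          using component_edge_closed[OF G] 2 Z[OF yG] by blast
        then show False using Z[OF yG] by blast
      qed
    qed (use dec in blast)
  qed
  have leave: "\<exists>n. x \<notin> C n" if "(r 0, x) \<in> (adj G)\<^sup>*" for x
    using that
  proof (induction rule: rtrancl_induct)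
    case base
    have "r 0 \<notin> C 0" using component_subset[OF comp[of 0]] by (auto simp: X0)
    then show ?case ..
  next
    case (step y z)
    then obtain n where "y \<notin> C n" by blast
    then have "z \<notin> C (Suc n)"
      using nbhd[of n] step(2) unfolding closed_nbhd_def adj_iff by auto
    then show ?case ..
  qed
  have "\<exists>n. x \<notin> C n" for x
  proof (cases "x \<in> C 0")
    case True
    then obtain N where N: "(x, r N) \<in> (adj (delete_verts G (X 0)))\<^sup>*"
      unfolding C_def ray_component_def by blast
    have "adj (delete_verts G (X 0)) \<subseteq> adj G" by (auto simp: adj_delete_verts adj_iff[of _ _ G])
    then have "(x, r N) \<in> (adj G)\<^sup>*" using N rtrancl_mono by blast
    moreover have "(r 0, r N) \<in> (adj G)\<^sup>*"
      using ray_reach[of G 0 r 0 N] r by (simp add: ray_tail_def)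
    ultimately show ?thesis using leave by (meson reach_sym rtrancl_trans)
  qed blast
  then have "end_basis G C"
    unfolding end_basis_def using comp dec X nbhd by (metis decseq_Suc_iff subsetD)
  moreover have "ray_follows C r"
    unfolding ray_follows_def C_def using ray_eventually_in_component[OF r] X by blast
  ultimately show ?thesis using that by blast
qed

section \<open>Rays through vertices that finite edge sets do not separate\<close>

text \<open>
  The end with basis \<open>C\<close> can be approached from \<open>x\<close> inside \<open>S\<close> after the deletion of any edge set
  in \<open>\<F>\<close>. The family \<open>\<F>\<close> will consist of all finite edge sets, or of the empty set only.
\<close>
definition linked ::
  "'a ugraph \<Rightarrow> (nat \<Rightarrow> 'a set) \<Rightarrow> 'a set set set \<Rightarrow> 'a set \<Rightarrow> 'a \<Rightarrow> bool" where
  "linked G C \<F> S x \<longleftrightarrow>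
     (\<forall>F\<in>\<F>. \<forall>N. \<exists>z\<in>C N. (x, z) \<in> (Restr (adj (delete_edges G F)) S)\<^sup>*)"

lemma last_exit:
  assumes "(x, z) \<in> R\<^sup>*" "x \<notin> D" "z \<in> D"
  shows "\<exists>y w. (x, y) \<in> R\<^sup>* \<and> y \<notin> D \<and> (y, w) \<in> R \<and> w \<in> D \<and> (w, z) \<in> (Restr R D)\<^sup>*"
  using assms
proof (induction rule: rtrancl_induct)
  case (step a b)
  show ?case
  proof (cases "a \<in> D")
    case True
    with step obtain y w where yw: "(x, y) \<in> R\<^sup>*" "y \<notin> D" "(y, w) \<in> R" "w \<in> D"
      "(w, a) \<in> (Restr R D)\<^sup>*" by blast
    then have "(w, b) \<in> (Restr R D)\<^sup>*" using True step by (auto intro: rtrancl_into_rtrancl)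
    with yw show ?thesis by blast
  qed (use step in blast)
qed simp

lemma directed_finite_Union:
  assumes "finite Y" "{} \<in> \<F>" "\<And>F F'. F \<in> \<F> \<Longrightarrow> F' \<in> \<F> \<Longrightarrow> F \<union> F' \<in> \<F>"
    "\<And>y. y \<in> Y \<Longrightarrow> f y \<in> \<F>"
  shows "(\<Union>y\<in>Y. f y) \<in> \<F>"
  using assms(1,4) by (induction Y) (auto intro: assms)

context
  fixes G :: "'a ugraph" and C :: "nat \<Rightarrow> 'a set" and \<F> :: "'a set set set"
  assumes G: "is_graph G" and C: "end_basis G C"
    and \<F>: "{} \<in> \<F>" "\<And>F F'. F \<in> \<F> \<Longrightarrow> F' \<in> \<F> \<Longrightarrow> F \<union> F' \<in> \<F>"
begin

text \<open>
  The last vertex outside \<open>D\<close> on a path towards the end lies in \<open>Y\<close>. As \<open>Y\<close> is finite and \<open>\<F>\<close> is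
  directed, one vertex of \<open>Y\<close> serves for all edge sets in \<open>\<F>\<close> and all members of the basis: otherwise
  the finitely many sets that exclude the vertices of \<open>Y\<close> have a union that excludes all of them.
\<close>
lemma linked_relocate:
  assumes x: "linked G C \<F> S x" "x \<in> S" "x \<notin> D" and D: "D \<subseteq> S" "C N0 \<inter> S \<subseteq> D"
    and Y: "finite Y" "\<And>w d. w \<in> S - D \<Longrightarrow> d \<in> D \<Longrightarrow> {w, d} \<in> edges G \<Longrightarrow> w \<in> Y"
  obtains y where "y \<in> Y" "y \<in> S" "y \<notin> D" "linked G C \<F> (insert y D) y"
    "\<And>F. F \<in> \<F> \<Longrightarrow> (x, y) \<in> (Restr (adj (delete_edges G F)) S)\<^sup>*"
proof -
  let ?R = "\<lambda>F S. Restr (adj (delete_edges G F)) S"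
  let ?bad = "\<lambda>y F N. (x, y) \<notin> (?R F S)\<^sup>* \<or> (\<forall>z\<in>C N. (y, z) \<notin> (?R F (insert y D))\<^sup>*)"
  have R_mono: "(a, b) \<in> (?R F' T)\<^sup>*" if "(a, b) \<in> (?R F T)\<^sup>*" "F' \<subseteq> F" for a b F F' T
    using that(1) by (rule rtrancl_mono[THEN subsetD, rotated]) (use adj_delete_mono(1)[OF that(2), of G] in blast)
  have "\<exists>y\<in>Y \<inter> S - D. \<forall>F\<in>\<F>. \<forall>N. \<not> ?bad y F N"
  proof (rule ccontr)
    assume *: "\<not> (\<exists>y\<in>Y \<inter> S - D. \<forall>F\<in>\<F>. \<forall>N. \<not> ?bad y F N)"
    have "\<forall>y\<in>Y \<inter> S - D. \<exists>p. fst p \<in> \<F> \<and> ?bad y (fst p) (snd p)"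
      (is "\<forall>y\<in>_. ?p y")
    proof (rule ballI)
      fix y assume "y \<in> Y \<inter> S - D"
      with * obtain F N where "F \<in> \<F>" "?bad y F N" by blast
      then show "?p y" by (intro exI[of _ "(F, N)"]) simp
    qed
    from bchoice[OF this] obtain p where
      p: "\<forall>y\<in>Y \<inter> S - D. fst (p y) \<in> \<F> \<and> ?bad y (fst (p y)) (snd (p y))" by (rule exE)
    define F where "F = (\<Union>y\<in>Y \<inter> S - D. fst (p y))"
    have F: "F \<in> \<F>"
      unfolding F_def by (rule directed_finite_Union) (use Y(1) \<F> p in auto)
    define N where "N = Max (insert N0 ((\<lambda>y. snd (p y)) ` (Y \<inter> S - D)))"
    have N0: "N0 \<le> N" unfolding N_def using Y(1) by (intro Max_ge) auto
    have N: "snd (p y) \<le> N" if "y \<in> Y \<inter> S - D" for y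
      unfolding N_def using Y(1) that by (intro Max_ge) auto
    obtain z where z: "z \<in> C N" "(x, z) \<in> (?R F S)\<^sup>*" using x(1) F unfolding linked_def by blast
    have in_S: "b \<in> S" if "(x, b) \<in> (?R F S)\<^sup>*" for b
      using that x(2) by (induction rule: rtrancl_induct) auto
    have "z \<in> D" using in_S[OF z(2)] z(1) end_basis_decseq[OF G C N0] D(2) by blast
    from last_exit[OF z(2) x(3) this] obtain y w where
      yw: "(x, y) \<in> (?R F S)\<^sup>*" "y \<notin> D" "(y, w) \<in> ?R F S" "w \<in> D" "(w, z) \<in> (Restr (?R F S) D)\<^sup>*"
      by blast
    have "{y, w} \<in> edges G" using yw(3) by (simp add: adj_delete_edges)
    then have y: "y \<in> Y \<inter> S - D" using Y(2)[of y w] yw in_S[OF yw(1)] by blast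
    have "Restr (?R F S) D \<subseteq> ?R F (insert y D)" by blast
    then have "(w, z) \<in> (?R F (insert y D))\<^sup>*" using yw(5) rtrancl_mono by blast
    moreover have "(y, w) \<in> ?R F (insert y D)" using yw(3,4) by blast
    ultimately have yz: "(y, z) \<in> (?R F (insert y D))\<^sup>*" by (rule converse_rtrancl_into_rtrancl[rotated])
    have "fst (p y) \<subseteq> F" unfolding F_def using y by blast
    then have "(x, y) \<in> (?R (fst (p y)) S)\<^sup>*" "(y, z) \<in> (?R (fst (p y)) (insert y D))\<^sup>*"
      using R_mono yw(1) yz by blast+
    moreover have "z \<in> C (snd (p y))" using z(1) end_basis_decseq[OF G C N[OF y]] by blast
    ultimately show False using p y by blast
  qed
  then obtain y where y: "y \<in> Y \<inter> S - D" "\<forall>F\<in>\<F>. \<forall>N. \<not> ?bad y F N" by (rule bexE)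
  show ?thesis
  proof (rule that)
    show "linked G C \<F> (insert y D) y" unfolding linked_def using y(2) by blast
    show "(x, y) \<in> (?R F S)\<^sup>*" if "F \<in> \<F>" for F using y(2) that by blast
  qed (use y(1) in auto)
qed

text \<open>
  The first application of the relocation lemma moves from \<open>x\<close> to a vertex \<open>y\<close> on the boundary of a
  late \<open>C m\<close>. A path to \<open>y\<close> may already have used vertices of \<open>C m\<close>; the second application moves
  to the vertex \<open>p\<close> of that path at which the path can be left for good.
\<close>
lemma linked_step:
  assumes x: "linked G C \<F> (insert x S) x" "x \<notin> S" "x \<in> verts G" and S: "S \<subseteq> verts G"
  obtains P p S' where "is_path G P" "hd P = x" "last P = p" "set P \<subseteq> insert x S" "p \<noteq> x"
    "set P \<inter> S' = {}" "S' \<subseteq> S \<inter> C k" "p \<in> S" "linked G C \<F> (insert p S') p"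
    "\<forall>F\<in>\<F>. (x, p) \<in> (adj (delete_edges G F))\<^sup>*"
proof -
  obtain n where n: "\<forall>m\<ge>n. closed_nbhd G (C m) \<inter> {x} = {}"
    using end_basis_avoids[OF G C, of "{x}"] by auto
  define m where "m = n + k"
  have x_m: "x \<notin> closed_nbhd G (C m)" using n by (auto simp: m_def)
  have C_mk: "C m \<subseteq> C k" using end_basis_decseq[OF G C, of k m] by (simp add: m_def)
  define D where "D = S \<inter> C m"
  obtain y where y: "y \<in> closed_nbhd G (C m) - C m" "y \<in> insert x S" "y \<notin> D"
    "linked G C \<F> (insert y D) y"
    "\<And>F. F \<in> \<F> \<Longrightarrow> (x, y) \<in> (Restr (adj (delete_edges G F)) (insert x S))\<^sup>*"
  proof (rule linked_relocate[OF x(1), of D m "closed_nbhd G (C m) - C m"])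
    show "finite (closed_nbhd G (C m) - C m)" by (rule finite_boundary[OF G C])
    show "C m \<inter> insert x S \<subseteq> D" using x_m subset_closed_nbhd[of "C m" G] unfolding D_def by blast
    show "w \<in> closed_nbhd G (C m) - C m" if "w \<in> insert x S - D" "d \<in> D" "{w, d} \<in> edges G" for w d
      using that x_m subset_closed_nbhd[of "C m" G] unfolding D_def closed_nbhd_def by blast
  qed (use x(2) in \<open>auto simp: D_def\<close>)
  have "Restr (adj (delete_edges G {})) (insert x S) \<subseteq> Restr (adj G) (insert x S)"
    by (auto simp: adj_delete_edges adj_iff[of _ _ G])
  then have "(x, y) \<in> (Restr (adj G) (insert x S))\<^sup>*" using y(5)[OF \<F>(1)] rtrancl_mono by blast
  then obtain P where P: "is_path G P" "hd P = x" "last P = y" "set P \<subseteq> insert x S"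
    using path_within[of x y G "insert x S"] x(3) S by blast
  have yP: "y \<in> set P" using P(1,3) unfolding is_path_def by auto
  define S' where "S' = D - set P"
  obtain N where N: "\<forall>m\<ge>N. closed_nbhd G (C m) \<inter> set P = {}"
    using end_basis_avoids[OF G C, of "set P"] by auto
  obtain p where p: "p \<in> set P" "p \<in> insert y D" "p \<notin> S'" "linked G C \<F> (insert p S') p"
    "\<And>F. F \<in> \<F> \<Longrightarrow> (y, p) \<in> (Restr (adj (delete_edges G F)) (insert y D))\<^sup>*"
  proof (rule linked_relocate[OF y(4), of S' N "set P"])
    have "C N \<inter> set P = {}" using N subset_closed_nbhd[of "C N" G] by blast
    then show "C N \<inter> insert y D \<subseteq> S'" using yP unfolding S'_def by blast
  qed (use yP in \<open>auto simp: S'_def\<close>)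
  obtain xs ys where split: "P = xs @ p # ys" using p(1) by (meson split_list)
  show ?thesis
  proof (rule that[of "xs @ [p]" p S'])
    show "is_path G (xs @ [p])"
      using P(1) unfolding split by (auto simp: is_path_iff_successively successively_append_iff)
    show "hd (xs @ [p]) = x" using P(2) unfolding split by (cases xs) auto
    show "set (xs @ [p]) \<subseteq> insert x S" using P(4) unfolding split by auto
    show "set (xs @ [p]) \<inter> S' = {}" unfolding S'_def split by auto
    show "S' \<subseteq> S \<inter> C k" using C_mk unfolding S'_def D_def by auto
    show "p \<noteq> x" using p(2) y(1) x_m x(2) unfolding D_def by auto
    then show "p \<in> S" using p(2) y(2) y(1) x_m unfolding D_def by auto
    show "linked G C \<F> (insert p S') p" by (rule p(4))
    show "\<forall>F\<in>\<F>. (x, p) \<in> (adj (delete_edges G F))\<^sup>*"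
    proof
      fix F assume F: "F \<in> \<F>"
      have "(x, y) \<in> (adj (delete_edges G F))\<^sup>*" "(y, p) \<in> (adj (delete_edges G F))\<^sup>*"
        using y(5)[OF F] p(5)[OF F] by (meson Int_lower1 rtrancl_mono subsetD)+
      then show "(x, p) \<in> (adj (delete_edges G F))\<^sup>*" by (rule rtrancl_trans)
    qed
  qed simp
qed

text \<open>
  Iterating the step produces vertices \<open>u n\<close> that no member of \<open>\<F>\<close> separates from \<open>x\<close>, together
  with paths between consecutive ones that fit the concatenation lemma.
\<close>
lemma linked_ray:
  assumes x: "x \<in> verts G" "linked G C \<F> (verts G) x"
  obtains R where "is_ray G R" "ray_follows C R"
    "infinite (range R \<inter> {y. \<forall>F\<in>\<F>. (x, y) \<in> (adj (delete_edges G F))\<^sup>*})"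
proof -
  define ok where "ok = (\<lambda>(u, S). linked G C \<F> (insert u S) u \<and> u \<notin> S \<and> u \<in> verts G \<and> S \<subseteq> verts G \<and>
    (\<forall>F\<in>\<F>. (x, u) \<in> (adj (delete_edges G F))\<^sup>*))"
  define nxt where "nxt k = (\<lambda>(u, S) (u', S'). \<exists>P. is_path G P \<and> hd P = u \<and> last P = u' \<and>
    set P \<subseteq> insert u S \<and> u' \<noteq> u \<and> set P \<inter> S' = {} \<and> S' \<subseteq> S \<inter> C k \<and> u' \<in> S)" for k :: nat
  have "\<exists>f. \<forall>n. ok (f n) \<and> nxt n (f n) (f (Suc n))"
  proof (rule dependent_nat_choice[of "\<lambda>_. ok" nxt])
    have "insert x (verts G - {x}) = verts G" using x(1) by blast
    then have "ok (x, verts G - {x})" using x unfolding ok_def by simp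
    then show "\<exists>a. ok a" ..
  next
    fix a k assume "ok a"
    then obtain u S where a: "a = (u, S)" and u: "linked G C \<F> (insert u S) u" "u \<notin> S" "u \<in> verts G"
      "S \<subseteq> verts G" "\<forall>F\<in>\<F>. (x, u) \<in> (adj (delete_edges G F))\<^sup>*"
      unfolding ok_def by (cases a) auto
    obtain P p S' where P: "is_path G P" "hd P = u" "last P = p" "set P \<subseteq> insert u S" "p \<noteq> u"
      "set P \<inter> S' = {}" "S' \<subseteq> S \<inter> C k" "p \<in> S" "linked G C \<F> (insert p S') p"
      "\<forall>F\<in>\<F>. (u, p) \<in> (adj (delete_edges G F))\<^sup>*"
      using linked_step[OF u(1-4), where k = k] .
    have "nxt k a (p, S')" unfolding nxt_def a using P(1-8) by blast
    moreover have "p \<in> set P" using P(1,3) unfolding is_path_def by auto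
    then have "p \<notin> S'" using P(6) by blast
    moreover have "p \<in> verts G" "S' \<subseteq> verts G" using P(7,8) u(4) by auto
    moreover have "\<forall>F\<in>\<F>. (x, p) \<in> (adj (delete_edges G F))\<^sup>*"
      using u(5) P(10) by (blast intro: rtrancl_trans)
    ultimately show "\<exists>b. ok b \<and> nxt k a b" using P(9) unfolding ok_def by (intro exI[of _ "(p, S')"]) auto
  qed
  then obtain f where f: "\<forall>n. ok (f n) \<and> nxt n (f n) (f (Suc n))" by blast
  define u where "u n = fst (f n)" for n
  define S where "S n = snd (f n)" for n
  have ok: "ok (u n, S n)" and nxt: "nxt n (u n, S n) (u (Suc n), S (Suc n))" for n
    using f by (simp_all add: u_def S_def)
  have u: "u n \<notin> S n" "u n \<in> {y. \<forall>F\<in>\<F>. (x, y) \<in> (adj (delete_edges G F))\<^sup>*}" for n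
    using ok[of n] unfolding ok_def by simp_all
  have "\<forall>n. \<exists>P. is_path G P \<and> hd P = u n \<and> last P = u (Suc n) \<and> set P \<subseteq> insert (u n) (S n) \<and>
      u (Suc n) \<noteq> u n \<and> set P \<inter> S (Suc n) = {} \<and> S (Suc n) \<subseteq> S n \<inter> C n \<and> u (Suc n) \<in> S n"
    using nxt unfolding nxt_def by simp
  from choice[OF this] obtain P where P: "\<forall>n. is_path G (P n) \<and> hd (P n) = u n \<and>
      last (P n) = u (Suc n) \<and> set (P n) \<subseteq> insert (u n) (S n) \<and> u (Suc n) \<noteq> u n \<and>
      set (P n) \<inter> S (Suc n) = {} \<and> S (Suc n) \<subseteq> S n \<inter> C n \<and> u (Suc n) \<in> S n" by (rule exE)
  then have S_dec: "S (Suc n) \<subseteq> S n" and S_C: "S (Suc n) \<subseteq> C n" and u_S: "u (Suc n) \<in> S n" for n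
    by auto
  obtain R where R: "is_ray G R" "range u \<subseteq> range R" "\<And>k. \<exists>N. \<forall>i\<ge>N. R i \<in> S k"
    by (rule concatenate_paths[of G P u S]) (use P u(1) in auto)
  have S_mono: "S n \<subseteq> S m" if "m \<le> n" for m n
    using that by (induction rule: dec_induct) (use S_dec in auto)
  have "inj u"
  proof (rule linorder_injI)
    fix m n :: nat assume "m < n"
    then obtain k where k: "n = Suc k" "m \<le> k" by (cases n) auto
    then have "u n \<in> S m" using u_S[of k] S_mono[of m k] by auto
    then show "u m \<noteq> u n" using u(1)[of m] by auto
  qed
  then have "infinite (range u)" by (rule range_inj_infinite)
  moreover have "range u \<subseteq> range R \<inter> {y. \<forall>F\<in>\<F>. (x, y) \<in> (adj (delete_edges G F))\<^sup>*}"
    using R(2) u(2) by auto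
  ultimately have "infinite (range R \<inter> {y. \<forall>F\<in>\<F>. (x, y) \<in> (adj (delete_edges G F))\<^sup>*})"
    using finite_subset by blast
  moreover have "ray_follows C R"
    unfolding ray_follows_def using R(3) S_C by (meson subsetD)
  ultimately show ?thesis using that R(1) by blast
qed

end

text \<open>
  With \<open>\<F> = {{}}\<close> the construction above needs only a vertex from which all \<open>C n\<close> can be reached, and
  in the connected set \<open>C 0\<close> every vertex is of this kind.
\<close>
lemma end_basis_has_ray:
  assumes G: "is_graph G" and C: "end_basis G C"
  obtains R where "is_ray G R" "ray_follows C R"
proof -
  obtain x where x: "x \<in> C 0" using end_basis_nonempty[OF G C, of 0] by blast
  have "linked G C {{}} (verts G) x"
    unfolding linked_def
  proof (intro ballI allI)
    fix F :: "'a set set" and N assume "F \<in> {{}}"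
    obtain z where z: "z \<in> C N" using end_basis_nonempty[OF G C, of N] by blast
    then have "(x, z) \<in> (Restr (adj G) (C 0))\<^sup>*"
      using end_basis_connected[OF G C x, of z] end_basis_decseq[OF G C, of 0 N] by blast
    moreover have "Restr (adj G) (C 0) \<subseteq> Restr (adj (delete_edges G F)) (verts G)"
      using end_basis_subset[OF G C, of 0] \<open>F \<in> {{}}\<close>
      by (auto simp: adj_delete_edges adj_iff[of _ _ G])
    ultimately have "(x, z) \<in> (Restr (adj (delete_edges G F)) (verts G))\<^sup>*"
      using rtrancl_mono by blast
    with z show "\<exists>z\<in>C N. (x, z) \<in> (Restr (adj (delete_edges G F)) (verts G))\<^sup>*" by blast
  qed
  moreover have "x \<in> verts G" using x end_basis_subset[OF G C, of 0] by blast
  ultimately show ?thesis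
    using linked_ray[OF G C, of "{{}}" x] that by auto
qed

section \<open>Edge classes and non-dominated rays\<close>

lemma edge_class_eq:
  assumes "v \<in> verts G"
  shows "edge_class G v =
    {u \<in> verts G. \<forall>F. finite F \<and> F \<subseteq> edges G \<longrightarrow> (v, u) \<in> (adj (delete_edges G F))\<^sup>*}"
proof -
  have "(\<exists>C\<in>graph_components (delete_edges G F). u \<in> C \<and> v \<in> C) \<longleftrightarrow>
      (v, u) \<in> (adj (delete_edges G F))\<^sup>*" if u: "u \<in> verts G" for u F
  proof
    assume "\<exists>C\<in>graph_components (delete_edges G F). u \<in> C \<and> v \<in> C"
    then obtain w where "(w, u) \<in> (adj (delete_edges G F))\<^sup>*" "(w, v) \<in> (adj (delete_edges G F))\<^sup>*"
      unfolding graph_components_def by blast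
    then show "(v, u) \<in> (adj (delete_edges G F))\<^sup>*" by (meson reach_sym rtrancl_trans)
  next
    assume "(v, u) \<in> (adj (delete_edges G F))\<^sup>*"
    then show "\<exists>C\<in>graph_components (delete_edges G F). u \<in> C \<and> v \<in> C"
      using assms u unfolding graph_components_def
      by (intro bexI[of _ "{u \<in> verts (delete_edges G F). (v, u) \<in> (adj (delete_edges G F))\<^sup>*}"]) auto
  qed
  then show ?thesis unfolding edge_class_def by blast
qed

definition edge_dominates :: "'a ugraph \<Rightarrow> 'a \<Rightarrow> (nat \<Rightarrow> 'a) \<Rightarrow> bool" where
  "edge_dominates G x r \<longleftrightarrow> x \<in> verts G \<and>
     (\<forall>F. finite F \<and> F \<subseteq> edges G \<longrightarrow> x \<in> ray_component (delete_edges G F) r)"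

text \<open>
  Apply the construction with all finite edge sets to a basis of the end of \<open>r\<close>: the vertices that
  no finite edge set separates from \<open>x\<close> are those of the edge class of \<open>x\<close>.
\<close>
lemma edge_dominates_equivalent_ray_in_class:
  assumes G: "is_graph G" and r: "is_ray G r" "nondominated G r" and x: "edge_dominates G x r"
  obtains R where "(r, R) \<in> ray_equiv G" "infinite (range R \<inter> edge_class G x)"
proof -
  obtain C where C: "end_basis G C" "ray_follows C r"
    using nondominated_has_end_basis[OF G r] .
  define \<F> where "\<F> = {F. finite F \<and> F \<subseteq> edges G}"
  have xG: "x \<in> verts G" using x unfolding edge_dominates_def by blast
  have "linked G C \<F> (verts G) x"
    unfolding linked_def
  proof (intro ballI allI)
    fix F N assume "F \<in> \<F>"
    then have F: "finite F" "F \<subseteq> edges G" unfolding \<F>_def by auto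
    obtain M where M: "\<forall>i\<ge>M. r i \<in> C N" using C(2) unfolding ray_follows_def by blast
    have "x \<in> ray_component (delete_edges G F) r" using x F unfolding edge_dominates_def by blast
    then obtain i where i: "i \<ge> M" "(x, r i) \<in> (adj (delete_edges G F))\<^sup>*"
      using in_ray_component_edges_iff[OF r(1) F(1) xG] by blast
    have "b \<in> verts G" if "a \<in> verts G" "(a, b) \<in> adj (delete_edges G F)" for a b
      using that G unfolding is_graph_def adj_delete_edges by blast
    then have "(x, r i) \<in> (Restr (adj (delete_edges G F)) (verts G))\<^sup>*"
      using reach_Restr_closed[OF i(2) xG] by blast
    then show "\<exists>z\<in>C N. (x, z) \<in> (Restr (adj (delete_edges G F)) (verts G))\<^sup>*"
      using M i(1) by blast
  qed
  moreover have "{} \<in> \<F>" "\<And>F F'. F \<in> \<F> \<Longrightarrow> F' \<in> \<F> \<Longrightarrow> F \<union> F' \<in> \<F>" unfolding \<F>_def by auto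
  ultimately obtain R where R: "is_ray G R" "ray_follows C R"
    "infinite (range R \<inter> {y. \<forall>F\<in>\<F>. (x, y) \<in> (adj (delete_edges G F))\<^sup>*})"
    using linked_ray[OF G C(1) _ _ xG, of \<F>] by blast
  have "range R \<inter> {y. \<forall>F\<in>\<F>. (x, y) \<in> (adj (delete_edges G F))\<^sup>*} \<subseteq> range R \<inter> edge_class G x"
    using R(1) unfolding edge_class_eq[OF xG] \<F>_def is_ray_def by blast
  then have "infinite (range R \<inter> edge_class G x)" using R(3) finite_subset by blast
  moreover have "(r, R) \<in> ray_equiv G" using ray_follows_equiv_iff[OF G C(1) r(1) R(1) C(2)] R(2) by blast
  ultimately show ?thesis using that by blast
qed

lemma ray_component_delete_edges:
  assumes "is_ray G r" "finite F"
  shows "ray_component (delete_edges G F) r \<in> graph_components (delete_edges G F)"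
    "\<exists>N. \<forall>i\<ge>N. r i \<in> ray_component (delete_edges G F) r"
proof -
  obtain n where n: "is_ray (delete_edges G F) (ray_tail n r)"
    using is_ray_tail_delete_edges[OF assms] by blast
  show "ray_component (delete_edges G F) r \<in> graph_components (delete_edges G F)"
    by (rule ray_component_in_components[OF n])
  have "r i \<in> ray_component (delete_edges G F) r" if "n \<le> i" for i
    using ray_component_eq[OF n that] by auto
  then show "\<exists>N. \<forall>i\<ge>N. r i \<in> ray_component (delete_edges G F) r" by blast
qed

text \<open>
  Otherwise finitely many edges separate every vertex of \<open>X\<close> from the tails of \<open>r\<close>. After the
  deletion of these edges, \<open>r\<close> and \<open>s\<close> still have tails in a common component, and this component
  avoids \<open>X\<close>, so that it joins the two tails in \<open>G - X\<close>.
\<close>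
lemma separator_has_edge_dominating_vertex:
  assumes G: "is_graph G" and rs: "(r, s) \<in> ray_edge_equiv G" and X: "finite X" "X \<subseteq> verts G"
    and sep: "ray_component (delete_verts G X) r \<noteq> ray_component (delete_verts G X) s"
  shows "\<exists>x\<in>X. edge_dominates G x r \<and> edge_dominates G x s"
proof -
  have r: "is_ray G r" and s: "is_ray G s"
    and eq: "\<And>F. finite F \<Longrightarrow> F \<subseteq> edges G \<Longrightarrow>
      ray_component (delete_edges G F) r = ray_component (delete_edges G F) s"
    using rs unfolding ray_edge_equiv_iff by blast+
  have "\<exists>x\<in>X. edge_dominates G x r"
  proof (rule ccontr)
    assume "\<not> (\<exists>x\<in>X. edge_dominates G x r)"
    then have "\<forall>x\<in>X. \<exists>F. (finite F \<and> F \<subseteq> edges G) \<and> x \<notin> ray_component (delete_edges G F) r"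
      using X(2) unfolding edge_dominates_def by blast
    from bchoice[OF this] obtain f where
      f: "\<forall>x\<in>X. (finite (f x) \<and> f x \<subseteq> edges G) \<and> x \<notin> ray_component (delete_edges G (f x)) r"
      by (rule exE)
    define F where "F = (\<Union>x\<in>X. f x)"
    have F: "finite F" "F \<subseteq> edges G" unfolding F_def using X(1) f by auto
    let ?C = "ray_component (delete_edges G F) r"
    have "x \<notin> ?C" if "x \<in> X" for x
    proof -
      have "f x \<subseteq> F" unfolding F_def using that by blast
      then have "?C \<subseteq> ray_component (delete_edges G (f x)) r"
        by (intro ray_component_mono adj_delete_mono) auto
      then show ?thesis using f that by blast
    qed
    then have CX: "Restr (adj (delete_edges G F)) ?C \<subseteq> adj (delete_verts G X)"
      by (auto simp: adj_delete_edges adj_delete_verts)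
    obtain N1 where N1: "\<forall>i\<ge>N1. r i \<in> ?C" using ray_component_delete_edges(2)[OF r F(1)] by blast
    obtain N2 where N2: "\<forall>i\<ge>N2. s i \<in> ?C"
      using ray_component_delete_edges(2)[OF s F(1)] unfolding eq[OF F] by blast
    obtain N3 where N3: "\<forall>i\<ge>N3. r i \<in> ray_component (delete_verts G X) r"
      using ray_eventually_in_component[OF r X(1)] by blast
    obtain N4 where N4: "\<forall>i\<ge>N4. s i \<in> ray_component (delete_verts G X) s"
      using ray_eventually_in_component[OF s X(1)] by blast
    define i where "i = N1 + N2 + N3 + N4"
    have i: "r i \<in> ?C" "s i \<in> ?C" "r i \<in> ray_component (delete_verts G X) r"
      "s i \<in> ray_component (delete_verts G X) s"
      using N1 N2 N3 N4 by (auto simp: i_def)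
    have "(r i, s i) \<in> (Restr (adj (delete_edges G F)) ?C)\<^sup>*"
      by (rule component_connected[OF ray_component_delete_edges(1)[OF r F(1)] is_graph_delete(2)[OF G] i(1,2)])
    then have "(r i, s i) \<in> (adj (delete_verts G X))\<^sup>*" using CX rtrancl_mono by blast
    moreover have "s i \<in> verts (delete_verts G X)"
      using i(4) unfolding ray_component_def by blast
    ultimately have "s i \<in> ray_component (delete_verts G X) r"
      using component_closed[OF ray_component_in_components_delete_verts[OF r X(1)] i(3)] by blast
    then have "ray_component (delete_verts G X) r = ray_component (delete_verts G X) s"
      using components_disjoint[OF ray_component_in_components_delete_verts[OF r X(1)]
        ray_component_in_components_delete_verts[OF s X(1)] _ i(4)] by blast
    with sep show False ..
  qed
  then obtain x where x: "x \<in> X" "edge_dominates G x r" by blast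
  then have "edge_dominates G x s" using eq unfolding edge_dominates_def by blast
  with x show ?thesis by blast
qed

lemma infinite_range_Int_imp:
  fixes r :: "nat \<Rightarrow> 'a"
  assumes "infinite (range r \<inter> S)"
  shows "\<exists>i\<ge>N. r i \<in> S"
proof (rule ccontr)
  assume *: "\<not> (\<exists>i\<ge>N. r i \<in> S)"
  have "range r \<inter> S \<subseteq> r ` {..<N}"
  proof
    fix y assume "y \<in> range r \<inter> S"
    then obtain i where "y = r i" "r i \<in> S" by auto
    then show "y \<in> r ` {..<N}" using * by (cases "N \<le> i") (auto intro!: imageI)
  qed
  then have "finite (range r \<inter> S)" by (rule finite_subset) simp
  with assms show False ..
qed

lemma contains_ray_component:
  assumes r: "is_ray G r" and X: "finite X" and S: "infinite (range r \<inter> S)"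
  shows "contains_ray (S \<inter> ray_component (delete_verts G X) r) r"
proof -
  let ?C = "ray_component (delete_verts G X) r"
  obtain N where N: "\<forall>i\<ge>N. r i \<in> ?C"
    using ray_eventually_in_component[OF r X] by (rule exE)
  have "range r \<inter> S \<subseteq> (range r \<inter> (S \<inter> ?C)) \<union> r ` {..<N}"
  proof
    fix y assume "y \<in> range r \<inter> S"
    then obtain i where i: "y = r i" "r i \<in> S" by auto
    show "y \<in> (range r \<inter> (S \<inter> ?C)) \<union> r ` {..<N}"
      using N i by (cases "N \<le> i") (auto intro!: imageI)
  qed
  moreover have "finite (r ` {..<N})" by simp
  ultimately have "infinite (range r \<inter> (S \<inter> ?C))" using S by (metis finite_UnI finite_subset)
  then show ?thesis unfolding contains_ray_def .
qed

lemma component_of_contained_ray: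
  assumes r: "is_ray G r" and X: "finite X" and C: "C \<in> graph_components (delete_verts G X)"
    and "contains_ray (S \<inter> C) r"
  shows "C = ray_component (delete_verts G X) r"
proof -
  obtain N where N: "\<forall>i\<ge>N. r i \<in> ray_component (delete_verts G X) r"
    using ray_eventually_in_component[OF r X] by blast
  obtain i where "i \<ge> N" "r i \<in> S \<inter> C"
    using infinite_range_Int_imp assms(4) unfolding contains_ray_def by blast
  then show ?thesis
    using components_disjoint[OF C ray_component_in_components_delete_verts[OF r X], of "r i"] N by blast
qed

lemma edge_class_rays_edge_equiv:
  assumes v: "v \<in> verts G" and r: "is_ray G r" "infinite (range r \<inter> edge_class G v)"
    and s: "is_ray G s" "infinite (range s \<inter> edge_class G v)"
  shows "(r, s) \<in> ray_edge_equiv G"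
  unfolding ray_edge_equiv_iff
proof (intro conjI allI impI)
  fix F assume F: "finite F \<and> F \<subseteq> edges G"
  have v_in: "v \<in> ray_component (delete_edges G F) t"
    if t: "is_ray G t" "infinite (range t \<inter> edge_class G v)" for t
    unfolding in_ray_component_edges_iff[OF t(1) conjunct1[OF F] v]
  proof
    fix N
    obtain i where "i \<ge> N" "t i \<in> edge_class G v" using infinite_range_Int_imp[OF t(2)] by blast
    then show "\<exists>i\<ge>N. (v, t i) \<in> (adj (delete_edges G F))\<^sup>*"
      unfolding edge_class_eq[OF v] using F by blast
  qed
  have Ff: "finite F" using F ..
  show "ray_component (delete_edges G F) r = ray_component (delete_edges G F) s"
    by (rule components_disjoint[OF ray_component_delete_edges(1)[OF r(1) Ff]
        ray_component_delete_edges(1)[OF s(1) Ff] v_in[OF r] v_in[OF s]])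
qed (use r s in auto)

text \<open>
  If \<open>r\<close> and \<open>s\<close> were edge-equivalent and non-dominated but separated by a finite set \<open>X\<close>, a vertex
  \<open>x \<in> X\<close> edge-dominating both would have its edge class contain non-dominated rays in two components
  of \<open>G - X\<close>.
\<close>
theorem end_correlated_iff_edge_classes:
  assumes G: "is_graph G"
  shows "end_correlated G \<longleftrightarrow> (\<forall>F v. finite F \<and> F \<subseteq> verts G \<and> v \<in> verts G \<longrightarrow>
    (\<exists>\<^sub>\<le>\<^sub>1 C. C \<in> graph_components (delete_verts G F) \<and>
       (\<exists>r. is_ray G r \<and> nondominated G r \<and> contains_ray (edge_class G v \<inter> C) r)))"
    (is "_ \<longleftrightarrow> ?R")
proof
  assume cor: "end_correlated G"
  show ?R
  proof (intro allI impI Uniq_I, elim conjE exE)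
    fix F v C D r s
    assume F: "finite F" "F \<subseteq> verts G" and v: "v \<in> verts G"
      and C: "C \<in> graph_components (delete_verts G F)" and D: "D \<in> graph_components (delete_verts G F)"
      and r: "is_ray G r" "nondominated G r" "contains_ray (edge_class G v \<inter> C) r"
      and s: "is_ray G s" "nondominated G s" "contains_ray (edge_class G v \<inter> D) s"
    have inf: "infinite (range t \<inter> edge_class G v)" if "contains_ray (edge_class G v \<inter> E) t" for t E
      by (rule infinite_super[OF _ that[unfolded contains_ray_def]]) blast
    have "(r, s) \<in> ray_edge_equiv G"
      by (rule edge_class_rays_edge_equiv[OF v r(1) inf[OF r(3)] s(1) inf[OF s(3)]])
    then have "(r, s) \<in> ray_equiv G" using cor r s unfolding end_correlated_def by blast
    then have "ray_component (delete_verts G F) r = ray_component (delete_verts G F) s"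
      unfolding ray_equiv_iff using F by blast
    then show "D = C"
      using component_of_contained_ray[OF r(1) F(1) C r(3)]
        component_of_contained_ray[OF s(1) F(1) D s(3)] by simp
  qed
next
  assume R: ?R
  show "end_correlated G"
    unfolding end_correlated_def
  proof (intro allI impI, elim conjE, rule ccontr)
    fix r s
    assume r: "is_ray G r" "nondominated G r" and s: "is_ray G s" "nondominated G s"
      and rs: "(r, s) \<in> ray_edge_equiv G" and "(r, s) \<notin> ray_equiv G"
    then obtain X where X: "finite X" "X \<subseteq> verts G"
      and sep: "ray_component (delete_verts G X) r \<noteq> ray_component (delete_verts G X) s"
      unfolding ray_equiv_iff by blast
    obtain x where x: "x \<in> X" "edge_dominates G x r" "edge_dominates G x s"
      using separator_has_edge_dominating_vertex[OF G rs X sep] by blast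
    have *: "\<exists>R. is_ray G R \<and> nondominated G R \<and>
        contains_ray (edge_class G x \<inter> ray_component (delete_verts G X) t) R"
      if t: "is_ray G t" "nondominated G t" "edge_dominates G x t" for t
    proof -
      obtain R where R: "(t, R) \<in> ray_equiv G" "infinite (range R \<inter> edge_class G x)"
        using edge_dominates_equivalent_ray_in_class[OF G t] .
      have "is_ray G R" "ray_component (delete_verts G X) t = ray_component (delete_verts G X) R"
        using R(1) X unfolding ray_equiv_iff by blast+
      then show ?thesis
        using contains_ray_component[OF _ X(1) R(2)] nondominated_ray_equiv[OF G R(1)] t(2) by metis
    qed
    have "x \<in> verts G" using x(1) X(2) by blast
    with R X have "\<exists>\<^sub>\<le>\<^sub>1 C. C \<in> graph_components (delete_verts G X) \<and>
       (\<exists>r. is_ray G r \<and> nondominated G r \<and> contains_ray (edge_class G x \<inter> C) r)" by blast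
    then show False
      using *[OF r x(2)] *[OF s x(3)] sep ray_component_in_components_delete_verts[OF r(1) X(1)]
        ray_component_in_components_delete_verts[OF s(1) X(1)] by (blast dest: Uniq_D)
  qed
qed

section \<open>The topology of the 1-complex\<close>

lemma edge_endpoints:
  assumes "is_graph G" "{u, v} \<in> edges G"
  shows "u \<noteq> v" "u \<in> verts G" "v \<in> verts G"
proof -
  have "{u, v} \<subseteq> verts G \<and> card {u, v} = 2"
    using bspec[OF assms(1)[unfolded is_graph_def] assms(2)] .
  then show "u \<noteq> v" "u \<in> verts G" "v \<in> verts G" by auto
qed

lemma edge_point_0: "edge_point u v 0 = vertex_point u"
  by (auto simp: edge_point_def vertex_point_def)

lemma edge_point_1: "u \<noteq> v \<Longrightarrow> edge_point u v 1 = vertex_point v"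
  by (auto simp: edge_point_def vertex_point_def)

lemma edge_point_flip: "u \<noteq> v \<Longrightarrow> edge_point u v t = edge_point v u (1 - t)"
  by (auto simp: edge_point_def)

lemma edge_point_inj: "edge_point u v s = edge_point u v t \<Longrightarrow> s = t"
  by (auto simp: edge_point_def dest: fun_cong[where x = u])

definition support :: "('a \<Rightarrow> real) \<Rightarrow> 'a set" where
  "support p = {w. p w \<noteq> 0}"

lemma support_edge_point: "support (edge_point u v t) \<subseteq> {u, v}"
  by (auto simp: support_def edge_point_def)

lemma support_vertex_point: "support (vertex_point x) = {x}"
  by (auto simp: support_def vertex_point_def)

definition complex_points :: "'a ugraph \<Rightarrow> ('a \<Rightarrow> real) set" where
  "complex_points G = vertex_point ` verts G \<union>
     {edge_point u v t | u v t. {u, v} \<in> edges G \<and> 0 \<le> t \<and> t \<le> 1}"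

lemma vertex_in_complex_points [intro]: "x \<in> verts G \<Longrightarrow> vertex_point x \<in> complex_points G"
  unfolding complex_points_def by blast

lemma edge_in_complex_points [intro]:
  "{u, v} \<in> edges G \<Longrightarrow> 0 \<le> t \<Longrightarrow> t \<le> 1 \<Longrightarrow> edge_point u v t \<in> complex_points G"
  unfolding complex_points_def by blast

lemma complex_points_cases:
  assumes "is_graph G" "p \<in> complex_points G"
  obtains (vertex) x where "x \<in> verts G" "p = vertex_point x"
  | (inner) u v t where "{u, v} \<in> edges G" "0 < t" "t < 1" "p = edge_point u v t"
proof -
  consider x where "x \<in> verts G" "p = vertex_point x"
    | u v t where "{u, v} \<in> edges G" "0 \<le> t" "t \<le> 1" "p = edge_point u v t"
    using assms(2) unfolding complex_points_def by blast
  then show ?thesis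
  proof cases
    case (2 u v t)
    note uv = edge_endpoints[OF assms(1) 2(1)]
    consider "t = 0" | "t = 1" | "0 < t" "t < 1" using 2 by linarith
    then show ?thesis
    proof cases
      case 1
      then show ?thesis using vertex[of u] uv 2(4) edge_point_0[of u v] by simp
    next
      case t: 2
      then show ?thesis using vertex[of v] uv 2(4) edge_point_1[of u v] by simp
    qed (use inner 2 in blast)
  qed (use vertex in blast)
qed

lemma support_subset_verts:
  assumes "is_graph G" "p \<in> complex_points G"
  shows "support p \<subseteq> verts G" "finite (support p)" "support p \<noteq> {}"
proof -
  have "support p \<subseteq> verts G \<and> finite (support p) \<and> support p \<noteq> {}"
    using assms
  proof (cases rule: complex_points_cases)
    case (vertex x)
    then show ?thesis by (simp add: support_vertex_point)
  next
    case (inner u v t)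
    then have "u \<in> support p" by (auto simp: support_def edge_point_def)
    then show ?thesis
      using support_edge_point[of u v t] edge_endpoints[OF assms(1) inner(1)] inner(4)
      by (auto intro: finite_subset)
  qed
  then show "support p \<subseteq> verts G" "finite (support p)" "support p \<noteq> {}" by blast+
qed

lemma open_star_pos:
  assumes "is_graph G" "\<And>y. z y < 1" "p \<in> open_star G x z"
  shows "0 < p x"
  using assms(3) unfolding open_star_def
proof (elim insertE CollectE exE conjE)
  fix y t assume "p = edge_point x y t" "t < z y"
  then show ?thesis using assms(2)[of y] by (simp add: edge_point_def)
qed (simp add: vertex_point_def)

lemma edge_point_in_open_star_iff:
  assumes G: "is_graph G" and xy: "{x, y} \<in> edges G" and z: "\<And>y. 0 < z y \<and> z y < 1"
    and t: "0 \<le> t" "t \<le> 1"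
  shows "edge_point x y t \<in> open_star G x z \<longleftrightarrow> t < z y"
proof
  assume "edge_point x y t \<in> open_star G x z"
  then show "t < z y"
    unfolding open_star_def
  proof (elim insertE CollectE exE conjE)
    assume "edge_point x y t = vertex_point x"
    then have "t = 0" by (auto simp: edge_point_def vertex_point_def dest: fun_cong[where x = x])
    then show ?thesis using z by simp
  next
    fix y' s assume s: "edge_point x y t = edge_point x y' s" "{x, y'} \<in> edges G" "0 \<le> s" "s < z y'"
    have ne: "x \<noteq> y" "x \<noteq> y'" using edge_endpoints(1)[OF G] xy s(2) by auto
    have "t = s" using fun_cong[OF s(1), of x] by (simp add: edge_point_def)
    moreover have "y = y'" if "t \<noteq> 0"
      using fun_cong[OF s(1), of y] ne that by (auto simp: edge_point_def split: if_splits)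
    ultimately show ?thesis using s(4) z[of y] by (cases "t = 0") auto
  qed
qed (use xy t in \<open>auto simp: open_star_def\<close>)

lemma inner_edge_point_eq:
  assumes "u \<noteq> v" "u' \<noteq> v'" "0 < s" "s < 1" "edge_point u v t = edge_point u' v' s"
  shows "(u = u' \<and> v = v' \<and> t = s) \<or> (u = v' \<and> v = u' \<and> t = 1 - s)"
proof -
  have "u' \<in> support (edge_point u' v' s)" "v' \<in> support (edge_point u' v' s)"
    using assms by (auto simp: support_def edge_point_def)
  then have "{u', v'} \<subseteq> {u, v}" using support_edge_point[of u v t] assms(5) by auto
  then consider "u = u'" "v = v'" | "u = v'" "v = u'" using assms(1,2) by auto
  then show ?thesis
  proof cases
    case 1
    then show ?thesis using edge_point_inj assms(5) by metis
  next
    case 2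
    then show ?thesis using edge_point_inj[of u v t "1 - s"] edge_point_flip[of u' v' s] assms by metis
  qed
qed

lemma openin_unit_interval_less:
  "openin (top_of_set {0..1}) {t \<in> {0..1}. t < (a::real)}"
  "openin (top_of_set {0..1}) {t \<in> {0..1}. (a::real) < t}"
proof -
  have "{t \<in> {0..1}. t < a} = {0..1} \<inter> {..<a}" "{t \<in> {0..1}. a < t} = {0..1} \<inter> {a<..}" by auto
  then show "openin (top_of_set {0..1}) {t \<in> {0..1}. t < (a::real)}"
    "openin (top_of_set {0..1}) {t \<in> {0..1}. (a::real) < t}"
    by (simp_all only: openin_open_Int open_lessThan open_greaterThan)
qed

text \<open>
  This is the weak topology of a CW complex. The open stars generate it because their lengths can be
  chosen separately on every edge, without a positive lower bound.
\<close>
lemma openin_complex_iff: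
  assumes G: "is_graph G"
  shows "openin (complex_topology G) U \<longleftrightarrow> U \<subseteq> complex_points G \<and>
    (\<forall>u v. {u, v} \<in> edges G \<longrightarrow>
       openin (top_of_set {0..1}) {t \<in> {0..1}. edge_point u v t \<in> U})" (is "_ \<longleftrightarrow> ?R U")
proof
  define \<B> where "\<B> = {open_star G x z | x z. x \<in> verts G \<and> (\<forall>y. 0 < z y \<and> z y < 1)} \<union>
      {edge_point u v ` {a<..<b} | u v a b. {u, v} \<in> edges G \<and> 0 \<le> a \<and> a < b \<and> b \<le> 1}"
  have top: "complex_topology G = topology_generated_by \<B>"
    unfolding complex_topology_def \<B>_def by (rule refl)
  assume "openin (complex_topology G) U"
  then have "generate_topology_on \<B> U"
    unfolding top openin_topology_generated_by_iff .
  then show "?R U"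
  proof induction
    case (Int a b)
    have "{t \<in> {0..1}. edge_point u v t \<in> a \<inter> b} =
      {t \<in> {0..1}. edge_point u v t \<in> a} \<inter> {t \<in> {0..1}. edge_point u v t \<in> b}" for u v by auto
    then show ?case using Int by (auto intro: openin_Int)
  next
    case (UN K)
    have "{t \<in> {0..1}. edge_point u v t \<in> \<Union>K} = (\<Union>k\<in>K. {t \<in> {0..1}. edge_point u v t \<in> k})" for u v
      by auto
    moreover have "\<Union>K \<subseteq> complex_points G" using UN(2) by (intro Union_least) blast
    moreover have "openin (top_of_set {0..1}) (\<Union>k\<in>K. {t \<in> {0..1}. edge_point u v t \<in> k})"
      if "{u, v} \<in> edges G" for u v
      using UN(2) that by (intro openin_Union) blast
    ultimately show ?case by simp
  next
    case (Basis s)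
    then consider x z where "s = open_star G x z" "x \<in> verts G" "\<And>y. 0 < z y \<and> z y < 1"
      | u v a b where "s = edge_point u v ` {a<..<b}" "{u, v} \<in> edges G" "0 \<le> a" "a < b" "b \<le> 1"
      unfolding \<B>_def by blast
    then show ?case
    proof cases
      case (1 x z)
      have "s \<subseteq> complex_points G"
        using 1 unfolding open_star_def complex_points_def
        by auto (metis less_eq_real_def order_less_trans)
      moreover have "openin (top_of_set {0..1}) {t \<in> {0..1}. edge_point u v t \<in> s}"
        if uv: "{u, v} \<in> edges G" for u v
      proof -
        have ne: "u \<noteq> v" using edge_endpoints[OF G uv] by blast
        consider "x = u" | "x = v" | "x \<notin> {u, v}" by blast
        then show ?thesis
        proof cases
          case x: 1
          have "{t \<in> {0..1}. edge_point u v t \<in> s} = {t \<in> {0..1}. t < z v}"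
            using edge_point_in_open_star_iff[OF G uv 1(3)] unfolding 1(1) x by auto
          then show ?thesis using openin_unit_interval_less by simp
        next
          case x: 2
          have vu: "{v, u} \<in> edges G" using uv by (simp add: insert_commute)
          have "{t \<in> {0..1}. edge_point u v t \<in> s} = {t \<in> {0..1}. 1 - z u < t}"
            using edge_point_in_open_star_iff[OF G vu 1(3)] edge_point_flip[OF ne] unfolding 1(1) x by auto
          then show ?thesis using openin_unit_interval_less by simp
        next
          case x: 3
          have "edge_point u v t \<notin> s" for t
            using open_star_pos[OF G, of z "edge_point u v t" x] 1(3) x unfolding 1(1)
            by (auto simp: edge_point_def)
          then show ?thesis by simp
        qed
      qed
      ultimately show ?thesis by blast
    next
      case (2 u' v' a b)
      have "s \<subseteq> complex_points G" using 2 by (auto intro!: edge_in_complex_points)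
      moreover have "openin (top_of_set {0..1}) {t \<in> {0..1}. edge_point u v t \<in> s}"
        if uv: "{u, v} \<in> edges G" for u v
      proof -
        have ne: "u \<noteq> v" "u' \<noteq> v'" using edge_endpoints(1)[OF G] uv 2(2) by auto
        have mem: "edge_point u v t \<in> s \<longleftrightarrow>
          (u = u' \<and> v = v' \<and> a < t \<and> t < b) \<or> (u = v' \<and> v = u' \<and> 1 - b < t \<and> t < 1 - a)" for t
        proof
          assume "edge_point u v t \<in> s"
          then obtain r where r: "a < r" "r < b" "edge_point u v t = edge_point u' v' r"
            unfolding 2(1) by auto
          have "0 < r" "r < 1" using r 2 by auto
          then show "(u = u' \<and> v = v' \<and> a < t \<and> t < b) \<or> (u = v' \<and> v = u' \<and> 1 - b < t \<and> t < 1 - a)"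
            using inner_edge_point_eq[OF ne _ _ r(3)] r by auto
        next
          assume "(u = u' \<and> v = v' \<and> a < t \<and> t < b) \<or> (u = v' \<and> v = u' \<and> 1 - b < t \<and> t < 1 - a)"
          then show "edge_point u v t \<in> s"
          proof (elim disjE conjE)
            assume "u = v'" "v = u'" "1 - b < t" "t < 1 - a"
            then show ?thesis
              unfolding 2(1) using edge_point_flip[OF ne(1), of t] by (intro image_eqI[of _ _ "1 - t"]) auto
          qed (simp add: 2(1))
        qed
        consider "u = u'" "v = v'" | "u = v'" "v = u'" | "\<And>t. edge_point u v t \<notin> s" using mem by blast
        then show ?thesis
        proof cases
          case 1
          then have "{t \<in> {0..1}. edge_point u v t \<in> s} = {t \<in> {0..1}. a < t} \<inter> {t \<in> {0..1}. t < b}"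
            using mem ne by auto
          then show ?thesis by (simp only: openin_Int openin_unit_interval_less)
        next
          case 2
          then have "{t \<in> {0..1}. edge_point u v t \<in> s} =
              {t \<in> {0..1}. 1 - b < t} \<inter> {t \<in> {0..1}. t < 1 - a}"
            using mem ne by auto
          then show ?thesis by (simp only: openin_Int openin_unit_interval_less)
        qed simp
      qed
      ultimately show ?thesis by blast
    qed
  qed simp
next
  assume R: "?R U"
  have near: "\<exists>e>0. \<forall>s\<in>{0..1}. \<bar>s - t\<bar> < e \<longrightarrow> edge_point u v s \<in> U"
    if "{u, v} \<in> edges G" "t \<in> {0..1}" "edge_point u v t \<in> U" for u v t
    using R that unfolding openin_euclidean_subtopology_iff by (auto simp: dist_real_def)
  have "\<exists>T. openin (complex_topology G) T \<and> p \<in> T \<and> T \<subseteq> U" if p: "p \<in> U" for p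
  proof -
    have "p \<in> complex_points G" using p R by blast
    with G show ?thesis
    proof (cases rule: complex_points_cases)
      case (vertex x)
      have "\<forall>y. \<exists>e. 0 < e \<and> e < 1 \<and> ({x, y} \<in> edges G \<longrightarrow> (\<forall>t. 0 \<le> t \<and> t < e \<longrightarrow> edge_point x y t \<in> U))"
      proof
        fix y
        show "\<exists>e. 0 < e \<and> e < 1 \<and> ({x, y} \<in> edges G \<longrightarrow> (\<forall>t. 0 \<le> t \<and> t < e \<longrightarrow> edge_point x y t \<in> U))"
        proof (cases "{x, y} \<in> edges G")
          case True
          then obtain e where "e > 0" "\<forall>s\<in>{0..1}. \<bar>s - 0\<bar> < e \<longrightarrow> edge_point x y s \<in> U"
            using near[of x y 0] p vertex(2) by (auto simp: edge_point_0)
          then show ?thesis by (intro exI[of _ "min e (1/2)"]) auto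
        qed (intro exI[of _ "1/2"], simp)
      qed
      from choice[OF this] obtain z where z: "\<forall>y. 0 < z y \<and> z y < 1 \<and>
          ({x, y} \<in> edges G \<longrightarrow> (\<forall>t. 0 \<le> t \<and> t < z y \<longrightarrow> edge_point x y t \<in> U))" by (rule exE)
      have "openin (complex_topology G) (open_star G x z)"
        unfolding complex_topology_def
        by (rule topology_generated_by_Basis) (use z vertex(1) in blast)
      moreover have "p \<in> open_star G x z" unfolding open_star_def vertex(2) by simp
      moreover have "open_star G x z \<subseteq> U"
        using z p unfolding open_star_def vertex(2) by blast
      ultimately show ?thesis by blast
    next
      case (inner u v t)
      then obtain e where e: "e > 0" "\<forall>s\<in>{0..1}. \<bar>s - t\<bar> < e \<longrightarrow> edge_point u v s \<in> U"
        using near[of u v t] p by auto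
      let ?I = "{max 0 (t - e)<..<min 1 (t + e)}"
      have "openin (complex_topology G) (edge_point u v ` ?I)"
        unfolding complex_topology_def
        by (rule topology_generated_by_Basis, rule UnI2, rule CollectI, intro exI conjI, rule refl)
          (use inner e(1) in auto)
      moreover have "p \<in> edge_point u v ` ?I" using inner e(1) by auto
      moreover have "edge_point u v ` ?I \<subseteq> U" using e(2) by auto
      ultimately show ?thesis by blast
    qed
  qed
  then show "openin (complex_topology G) U" by (subst openin_subopen) blast
qed

definition region :: "'a ugraph \<Rightarrow> 'a set \<Rightarrow> ('a \<Rightarrow> real) set" where
  "region G C = {p \<in> complex_points G. \<exists>c\<in>C. 0 < p c}"

context
  fixes G :: "'a ugraph"
  assumes G: "is_graph G"
begin

lemma topspace_complex [simp]: "topspace (complex_topology G) = complex_points G"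
proof -
  have "{t \<in> {0..1}. edge_point u v t \<in> complex_points G} = {0..1}" if "{u, v} \<in> edges G" for u v
    using that by auto
  then have "openin (complex_topology G) (complex_points G)"
    unfolding openin_complex_iff[OF G] by simp
  moreover have "topspace (complex_topology G) \<subseteq> complex_points G"
    using openin_topspace[of "complex_topology G"] unfolding openin_complex_iff[OF G] by blast
  ultimately show ?thesis using openin_subset by blast
qed

lemma closedin_complex_iff:
  "closedin (complex_topology G) K \<longleftrightarrow> K \<subseteq> complex_points G \<and>
    (\<forall>u v. {u, v} \<in> edges G \<longrightarrow> closed {t \<in> {0..1}. edge_point u v t \<in> K})"
proof -
  have "openin (top_of_set {0..1}) {t \<in> {0..1}. edge_point u v t \<in> complex_points G - K} \<longleftrightarrow>
    closed {t \<in> {0..1}. edge_point u v t \<in> K}" (is "_ \<longleftrightarrow> closed ?K")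
    if "{u, v} \<in> edges G" for u v
  proof -
    have "{t \<in> {0..1}. edge_point u v t \<in> complex_points G - K} = {0..1} - ?K"
      using that by auto
    moreover have "openin (top_of_set {0..1}) ({0..1} - ?K) \<longleftrightarrow> closedin (top_of_set {0..1}) ?K"
      by (auto simp: closedin_def)
    moreover have "\<dots> \<longleftrightarrow> closed ?K" using closedin_closed_eq[of "{0..1::real}" ?K] by auto
    ultimately show ?thesis by simp
  qed
  then show ?thesis unfolding closedin_def openin_complex_iff[OF G] by auto
qed

lemma continuous_map_edge_point:
  assumes "{u, v} \<in> edges G"
  shows "continuous_map (top_of_set {0..1}) (complex_topology G) (edge_point u v)"
  unfolding continuous_map using assms by (auto simp: openin_complex_iff[OF G])

lemma edge_connectedin:
  assumes "{u, v} \<in> edges G" "connected I" "I \<subseteq> {0..1}"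
  shows "connectedin (complex_topology G) (edge_point u v ` I)"
  by (rule connectedin_continuous_map_image[OF continuous_map_edge_point[OF assms(1)]])
    (use assms in \<open>simp add: connectedin_subtopology\<close>)

lemma edge_compactin:
  assumes "{u, v} \<in> edges G"
  shows "compactin (complex_topology G) (edge_point u v ` {0..1})"
  by (rule image_compactin[OF _ continuous_map_edge_point[OF assms]])
    (simp add: compactin_subtopology)

lemma closedin_complex_if_finite_on_edges:
  assumes "D \<subseteq> complex_points G"
    and "\<And>u v. {u, v} \<in> edges G \<Longrightarrow> finite {p \<in> D. support p \<subseteq> {u, v}}"
  shows "closedin (complex_topology G) D"
  unfolding closedin_complex_iff
proof (intro conjI allI impI)
  fix u v assume uv: "{u, v} \<in> edges G"
  have "finite {t \<in> {0..1}. edge_point u v t \<in> D}"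
  proof (rule finite_imageD)
    show "finite (edge_point u v ` {t \<in> {0..1}. edge_point u v t \<in> D})"
      by (rule finite_subset[OF _ assms(2)[OF uv]]) (use support_edge_point[of u v] in auto)
    show "inj_on (edge_point u v) {t \<in> {0..1}. edge_point u v t \<in> D}"
      by (rule inj_onI) (rule edge_point_inj)
  qed
  then show "closed {t \<in> {0..1}. edge_point u v t \<in> D}" by (rule finite_imp_closed)
qed (rule assms(1))

text \<open>
  Choose one point of \<open>K\<close> for every support that occurs. On every edge this yields only finitely
  many points, so all subsets of the set \<open>D\<close> of chosen points are closed, and a compact set contains
  only finitely many points of such a set.
\<close>
lemma compact_finite_supports:
  assumes K: "compactin (complex_topology G) K"
  shows "finite (\<Union>p\<in>K. support p)"
proof -
  have KG: "K \<subseteq> complex_points G" using compactin_subset_topspace[OF K] by simp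
  define c where "c s = (SOME p. p \<in> K \<and> support p = s)" for s
  have c: "c (support p) \<in> K" "support (c (support p)) = support p" if "p \<in> K" for p
    unfolding c_def using someI[of "\<lambda>q. q \<in> K \<and> support q = support p" p] that by auto
  define D where "D = c ` support ` K"
  have inj: "p = q" if "p \<in> D" "q \<in> D" "support p = support q" for p q
    using that c(2) unfolding D_def by auto
  have closed: "closedin (complex_topology G) E" if "E \<subseteq> D" for E
  proof (rule closedin_complex_if_finite_on_edges)
    show "E \<subseteq> complex_points G" using that c(1) KG unfolding D_def by blast
    fix u v
    show "finite {p \<in> E. support p \<subseteq> {u, v}}"
    proof (rule finite_imageD)
      show "finite (support ` {p \<in> E. support p \<subseteq> {u, v}})"
        by (rule finite_subset[of _ "Pow {u, v}"]) auto
      show "inj_on support {p \<in> E. support p \<subseteq> {u, v}}"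
        by (rule inj_onI) (use inj that in blast)
    qed
  qed
  have "finite D"
  proof (cases "D = {}")
    case False
    define U where "U d = complex_points G - (D - {d})" for d
    have "openin (complex_topology G) (U d)" for d
      using openin_diff[OF openin_topspace[of "complex_topology G"] closed[of "D - {d}"]]
      unfolding U_def by auto
    moreover have "K \<subseteq> \<Union> (U ` D)"
    proof
      fix p assume p: "p \<in> K"
      obtain d where "d \<in> D" using False by blast
      with p KG show "p \<in> \<Union> (U ` D)" unfolding U_def by (cases "p \<in> D") blast+
    qed
    ultimately obtain \<V> where \<V>: "finite \<V>" "\<V> \<subseteq> U ` D" "K \<subseteq> \<Union>\<V>"
      using conjunct2[OF K[unfolded compactin_def], rule_format, of "U ` D"] by blast
    then obtain D' where D': "finite D'" "D' \<subseteq> D" "\<V> = U ` D'" by (meson finite_subset_image)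
    have "D \<subseteq> D'"
    proof
      fix d assume d: "d \<in> D"
      then have "d \<in> K" using c(1) unfolding D_def by blast
      then obtain e where "e \<in> D'" "d \<in> U e" using \<V>(3) D'(3) by blast
      then show "d \<in> D'" using d unfolding U_def by blast
    qed
    then show ?thesis using D'(1) finite_subset by blast
  qed simp
  then have "finite (support ` D)" by simp
  moreover have "support ` K \<subseteq> support ` D"
  proof (rule image_subsetI)
    fix p assume "p \<in> K"
    then show "support p \<in> support ` D"
      unfolding D_def using c(2)[of p] by (intro image_eqI[of _ _ "c (support p)"]) auto
  qed
  ultimately have "finite (support ` K)" using finite_subset by blast
  moreover have "finite s" if "s \<in> support ` K" for s
    using that support_subset_verts(2)[OF G] KG by auto
  ultimately show ?thesis by (rule finite_Union)
qed

section \<open>Open sets spanned by sets of vertices\<close>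

lemma region_mono: "C \<subseteq> D \<Longrightarrow> region G C \<subseteq> region G D"
  unfolding region_def by blast

lemma vertex_in_region_iff: "x \<in> verts G \<Longrightarrow> vertex_point x \<in> region G C \<longleftrightarrow> x \<in> C"
  unfolding region_def using vertex_in_complex_points[of x G]
  by (auto simp: vertex_point_def split: if_splits)

lemma edge_in_region_iff:
  assumes "{u, v} \<in> edges G" "0 \<le> t" "t \<le> 1"
  shows "edge_point u v t \<in> region G C \<longleftrightarrow> (u \<in> C \<and> t < 1) \<or> (v \<in> C \<and> 0 < t)"
  using assms edge_endpoints[OF G assms(1)] edge_in_complex_points[OF assms(1)]
  unfolding region_def by (auto simp: edge_point_def split: if_splits)

lemma openin_region: "openin (complex_topology G) (region G C)"
  unfolding openin_complex_iff[OF G]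
proof (intro conjI allI impI)
  fix u v assume uv: "{u, v} \<in> edges G"
  have "{t \<in> {0..1}. edge_point u v t \<in> region G C} =
      {t \<in> {0..1}. t < (if u \<in> C then 1 else 0)} \<union> {t \<in> {0..1}. (if v \<in> C then 0 else 1) < t}"
    using edge_in_region_iff[OF uv] by auto
  then show "openin (top_of_set {0..1}) {t \<in> {0..1}. edge_point u v t \<in> region G C}"
    by (simp only: openin_Un openin_unit_interval_less)
qed (auto simp: region_def)

text \<open>
  Every point of the region is joined within its edge to a vertex of \<open>C\<close>, and adjacent vertices of
  \<open>C\<close> are joined by the whole edge between them.
\<close>
lemma connectedin_region:
  assumes C: "C \<subseteq> verts G" "\<And>u w. u \<in> C \<Longrightarrow> w \<in> C \<Longrightarrow> (u, w) \<in> (Restr (adj G) C)\<^sup>*"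
  shows "connectedin (complex_topology G) (region G C)"
proof -
  define X where "X = subtopology (complex_topology G) (region G C)"
  have tX: "topspace X = region G C"
    unfolding X_def using openin_subset[OF openin_region[of C]] by auto
  have on_edge: "connected_component_of X (edge_point u v s) (edge_point u v t)"
    if uv: "{u, v} \<in> edges G" and I: "connected I" "I \<subseteq> {0..1}" "s \<in> I" "t \<in> I"
      "edge_point u v ` I \<subseteq> region G C" for u v s t I
    unfolding connected_component_of_def X_def
    using edge_connectedin[OF uv I(1,2)] I by (auto simp: connectedin_subtopology)
  have vertices: "connected_component_of X (vertex_point u) (vertex_point w)"
    if "u \<in> C" "w \<in> C" for u w
    using C(2)[OF that]
  proof (induction rule: rtrancl_induct)
    case base
    show ?case
      using that(1) C(1) vertex_in_region_iff[of u C] tX by (auto simp: connected_component_of_refl)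
  next
    case (step y z)
    have yz: "{y, z} \<in> edges G" "y \<in> C" "z \<in> C" using step(2) by (auto simp: adj_iff)
    have "connected_component_of X (edge_point y z 0) (edge_point y z 1)"
      by (rule on_edge[OF yz(1), of "{0..1}"]) (use edge_in_region_iff[OF yz(1)] yz in auto)
    then show ?case
      using step.IH edge_endpoints(1)[OF G yz(1)] connected_component_of_trans
      by (metis edge_point_0 edge_point_1)
  qed
  have to_vertex: "\<exists>c\<in>C. connected_component_of X p (vertex_point c)" if p: "p \<in> region G C" for p
  proof -
    obtain c where c: "c \<in> C" "0 < p c" and pG: "p \<in> complex_points G"
      using p unfolding region_def by blast
    have "connected_component_of X p (vertex_point c)"
      using G pG
    proof (cases rule: complex_points_cases)
      case (vertex x)
      then have "p = vertex_point c" using c(2) by (auto simp: vertex_point_def split: if_splits)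
      then show ?thesis using p tX by (simp add: connected_component_of_refl)
    next
      case (inner u v t)
      note ne = edge_endpoints(1)[OF G inner(1)]
      consider "c = u" | "c = v" using c(2) inner(4) by (auto simp: edge_point_def split: if_splits)
      then show ?thesis
      proof cases
        case 1
        have "connected_component_of X (edge_point u v t) (edge_point u v 0)"
          by (rule on_edge[OF inner(1), of "{0..<1}"])
            (use edge_in_region_iff[OF inner(1)] inner c 1 in auto)
        then show ?thesis using inner 1 by (simp add: edge_point_0)
      next
        case 2
        have "connected_component_of X (edge_point u v t) (edge_point u v 1)"
          by (rule on_edge[OF inner(1), of "{0<..1}"])
            (use edge_in_region_iff[OF inner(1)] inner c 2 in auto)
        then show ?thesis using inner 2 ne by (simp add: edge_point_1)
      qed
    qed
    with c(1) show ?thesis by blast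
  qed
  have "connected_component_of X p q" if "p \<in> region G C" "q \<in> region G C" for p q
  proof -
    obtain c d where "c \<in> C" "connected_component_of X p (vertex_point c)"
      "d \<in> C" "connected_component_of X q (vertex_point d)"
      using to_vertex \<open>p \<in> region G C\<close> \<open>q \<in> region G C\<close> by blast
    then show ?thesis
      using vertices connected_component_of_trans connected_component_of_sym by metis
  qed
  then have "connected_space X" unfolding connected_space_iff_connected_component tX by blast
  then show ?thesis
    unfolding connectedin_def X_def using openin_subset[OF openin_region[of C]] by simp
qed

text \<open>
  Only the far ends of half-open edges are added: an edge without ends in \<open>C\<close> meets the
  right-hand side in at most its two ends, and any other edge lies in it.
\<close>
lemma closure_region:
  assumes C: "C \<subseteq> verts G"
  shows "complex_topology G closure_of region G C =
    region G C \<union> vertex_point ` closed_nbhd G C"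
proof
  have nG: "closed_nbhd G C \<subseteq> verts G"
    using C G unfolding closed_nbhd_def is_graph_def by blast
  have "closedin (complex_topology G) (region G C \<union> vertex_point ` closed_nbhd G C)"
    unfolding closedin_complex_iff
  proof (intro conjI allI impI)
    show "region G C \<union> vertex_point ` closed_nbhd G C \<subseteq> complex_points G"
      using nG unfolding region_def by blast
    fix u v assume uv: "{u, v} \<in> edges G"
    note ne = edge_endpoints(1)[OF G uv]
    let ?T = "{t \<in> {0..1}. edge_point u v t \<in> region G C \<union> vertex_point ` closed_nbhd G C}"
    show "closed ?T"
    proof (cases "u \<in> C \<or> v \<in> C")
      case True
      have vu: "{v, u} \<in> edges G" using uv by (simp add: insert_commute)
      have nb: "u \<in> closed_nbhd G C" "v \<in> closed_nbhd G C"
        using True uv vu unfolding closed_nbhd_def by blast+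
      have "edge_point u v t \<in> region G C \<union> vertex_point ` closed_nbhd G C" if t: "t \<in> {0..1}" for t
      proof -
        consider "t = 0" | "t = 1" | "0 < t" "t < 1" using t by fastforce
        then show ?thesis
          using nb True edge_in_region_iff[OF uv, of t C] ne
          by cases (auto simp: edge_point_0 edge_point_1)
      qed
      then have "?T = {0..1}" by blast
      then show ?thesis by simp
    next
      case False
      have "t = 0 \<or> t = 1" if t: "t \<in> ?T" for t
      proof -
        have "edge_point u v t \<notin> region G C" using False t edge_in_region_iff[OF uv, of t C] by auto
        then obtain x where "edge_point u v t = vertex_point x" using t by blast
        then show ?thesis
          using ne by (auto simp: edge_point_def vertex_point_def dest!: fun_cong[where x = u] split: if_splits)
      qed
      then have "finite ?T" by (intro finite_subset[of ?T "{0, 1}"]) auto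
      then show ?thesis by (rule finite_imp_closed)
    qed
  qed
  then show "complex_topology G closure_of region G C \<subseteq> region G C \<union> vertex_point ` closed_nbhd G C"
    by (intro closure_of_minimal) auto
  have "vertex_point x \<in> complex_topology G closure_of region G C" if x: "x \<in> closed_nbhd G C" for x
    unfolding in_closure_of
  proof (intro conjI allI impI; (elim conjE)?)
    show "vertex_point x \<in> topspace (complex_topology G)" using x nG by auto
    fix U assume U: "vertex_point x \<in> U" "openin (complex_topology G) U"
    show "\<exists>p. p \<in> region G C \<and> p \<in> U"
    proof (cases "x \<in> C")
      case True
      then show ?thesis using U(1) vertex_in_region_iff C by blast
    next
      case False
      then obtain c where c: "c \<in> C" "{x, c} \<in> edges G" using x unfolding closed_nbhd_def by blast
      have "openin (top_of_set {0..1}) {t \<in> {0..1}. edge_point x c t \<in> U}"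
        using U(2) c(2) unfolding openin_complex_iff[OF G] by blast
      moreover have "0 \<in> {t \<in> {0..1::real}. edge_point x c t \<in> U}" using U(1) by (simp add: edge_point_0)
      ultimately obtain e where e: "e > 0"
        "\<forall>t\<in>{0..1}. dist t 0 < e \<longrightarrow> t \<in> {t \<in> {0..1}. edge_point x c t \<in> U}"
        unfolding openin_euclidean_subtopology_iff by meson
      define t where "t = min (e / 2) 1"
      have t: "0 < t" "t \<le> 1" "t < e" using e(1) by (auto simp: t_def)
      then have "edge_point x c t \<in> U" using e(2) by (auto simp: dist_real_def)
      then show ?thesis using edge_in_region_iff[OF c(2), of t C] t c(1) by auto
    qed
  qed
  then show "region G C \<union> vertex_point ` closed_nbhd G C \<subseteq> complex_topology G closure_of region G C"
    using closure_of_subset[OF openin_subset[OF openin_region[of C]]] by blast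
qed

lemma frontier_region:
  assumes "C \<subseteq> verts G"
  shows "complex_topology G frontier_of region G C \<subseteq> vertex_point ` (closed_nbhd G C - C)"
proof -
  have "complex_topology G frontier_of region G C =
      (region G C \<union> vertex_point ` closed_nbhd G C) - region G C"
    unfolding frontier_of_def closure_region[OF assms] interior_of_openin[OF openin_region] ..
  moreover have "vertex_point ` C \<subseteq> region G C"
    using vertex_in_region_iff[of _ C] assms by blast
  ultimately show ?thesis by blast
qed

end

section \<open>Topological ends and bases of ends\<close>

lemma connected_subset_component:
  assumes C: "C \<in> graph_components (delete_verts G X)"
    and D: "\<And>u w. u \<in> D \<Longrightarrow> w \<in> D \<Longrightarrow> (u, w) \<in> (Restr (adj G) D)\<^sup>*" "D \<subseteq> verts G" "D \<inter> X = {}"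
    and meet: "C \<inter> D \<noteq> {}"
  shows "D \<subseteq> C"
proof
  fix w assume w: "w \<in> D"
  obtain u where u: "u \<in> C" "u \<in> D" using meet by blast
  have "Restr (adj G) D \<subseteq> adj (delete_verts G X)"
    using D(3) by (auto simp: adj_delete_verts adj_iff[of _ _ G])
  then have "(u, w) \<in> (adj (delete_verts G X))\<^sup>*" using D(1)[OF u(2) w] rtrancl_mono by blast
  then show "w \<in> C" using component_closed[OF C u(1)] w D(2,3) by auto
qed

lemma equiv_top_end_equiv: "equiv {A. is_top_end_seq G A} (top_end_equiv G)"
proof (rule equivI)
  show "trans (top_end_equiv G)"
  proof (rule transI)
    fix A B C assume AB: "(A, B) \<in> top_end_equiv G" and BC: "(B, C) \<in> top_end_equiv G"
    have "\<exists>m k. C m \<subseteq> A n \<and> A k \<subseteq> C n" for n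
    proof -
      obtain m where m: "B m \<subseteq> A n" using AB unfolding top_end_equiv_def by blast
      obtain m' where m': "C m' \<subseteq> B m" using BC unfolding top_end_equiv_def by blast
      obtain k where k: "B k \<subseteq> C n" using BC unfolding top_end_equiv_def by blast
      obtain k' where "A k' \<subseteq> B k" using AB unfolding top_end_equiv_def by blast
      with m m' k show ?thesis by blast
    qed
    then show "(A, C) \<in> top_end_equiv G" using AB BC unfolding top_end_equiv_def by auto
  qed
qed (auto simp: refl_on_def sym_def top_end_equiv_def)

context
  fixes G :: "'a ugraph"
  assumes G: "is_graph G"
begin

lemma connectedin_region_component:
  assumes "C \<in> graph_components (delete_verts G X)"
  shows "connectedin (complex_topology G) (region G C)"
  using connectedin_region[OF G] component_connected_delete_verts[OF G assms]
    component_subset[OF assms] by auto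

lemma end_basis_top_end_seq:
  assumes C: "end_basis G C"
  shows "is_top_end_seq G (\<lambda>n. region G (C n))"
  unfolding is_top_end_seq_def
proof (intro conjI allI)
  have CG: "C n \<subseteq> verts G" for n by (rule end_basis_subset[OF G C])
  show "decseq (\<lambda>n. region G (C n))"
    unfolding decseq_def using region_mono[OF G end_basis_decseq[OF G C]] by blast
  fix n
  obtain c where "c \<in> C n" using end_basis_nonempty[OF G C, of n] by blast
  then have "vertex_point c \<in> region G (C n)" using CG vertex_in_region_iff[OF G] by blast
  then show "region G (C n) \<noteq> {}" by blast
  show "openin (complex_topology G) (region G (C n))" by (rule openin_region[OF G])
  show "connectedin (complex_topology G) (region G (C n))"
    by (rule end_basis_component[OF G C, of n]) (rule connectedin_region_component)
  have "finite (complex_topology G frontier_of region G (C n))"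
    by (rule finite_subset[OF frontier_region[OF G CG]]) (use finite_boundary[OF G C] in simp)
  then show "compactin (complex_topology G) (complex_topology G frontier_of region G (C n))"
    by (intro finite_imp_compactin frontier_of_subset_topspace)
next
  have CG: "C n \<subseteq> verts G" for n by (rule end_basis_subset[OF G C])
  show "(\<Inter>n. complex_topology G closure_of region G (C n)) = {}"
  proof (rule equals0I)
    fix p assume p: "p \<in> (\<Inter>n. complex_topology G closure_of region G (C n))"
    have "p \<in> topspace (complex_topology G)"
      by (rule subsetD[OF closure_of_subset_topspace INT_D[OF p UNIV_I]])
    then have "finite (support p)" using support_subset_verts(2)[OF G] topspace_complex[OF G] by simp
    from end_basis_avoids[OF G C this] obtain n where n: "closed_nbhd G (C n) \<inter> support p = {}"
      by blast
    have "p \<in> region G (C n) \<union> vertex_point ` closed_nbhd G (C n)"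
      using p closure_region[OF G CG] by blast
    then show False
    proof
      assume "p \<in> region G (C n)"
      then obtain c where "c \<in> C n" "c \<in> support p" by (auto simp: region_def support_def)
      then show False using n subset_closed_nbhd[of "C n" G] by blast
    next
      assume "p \<in> vertex_point ` closed_nbhd G (C n)"
      then show False using n by (auto simp: support_vertex_point)
    qed
  qed
qed

context
  fixes A :: "nat \<Rightarrow> ('a \<Rightarrow> real) set"
  assumes A: "is_top_end_seq G A"
begin

lemma
  shows top_end_seq_decseq: "m \<le> n \<Longrightarrow> A n \<subseteq> A m"
    and top_end_seq_nonempty: "A n \<noteq> {}"
    and top_end_seq_open: "openin (complex_topology G) (A n)"
    and top_end_seq_connected: "connectedin (complex_topology G) (A n)"
    and top_end_seq_frontier: "compactin (complex_topology G) (complex_topology G frontier_of A n)"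
    and top_end_seq_Inter: "(\<Inter>n. complex_topology G closure_of A n) = {}"
  using A unfolding is_top_end_seq_def by (auto simp: decseq_def)

lemma top_end_seq_subset: "A n \<subseteq> complex_points G"
  using openin_subset[OF top_end_seq_open] topspace_complex[OF G] by simp

text \<open>
  The complements of the closures form an increasing open cover, so one of them contains \<open>K\<close>.
\<close>
lemma top_end_seq_leaves_compact:
  assumes K: "compactin (complex_topology G) K"
  shows "\<exists>n. K \<inter> A n = {}"
proof -
  let ?U = "\<lambda>n. topspace (complex_topology G) - complex_topology G closure_of A n"
  have "K \<subseteq> \<Union> (range ?U)"
    using compactin_subset_topspace[OF K] top_end_seq_Inter by blast
  moreover have "\<forall>U\<in>range ?U. openin (complex_topology G) U" by auto
  ultimately obtain \<V> where \<V>: "finite \<V>" "\<V> \<subseteq> range ?U" "K \<subseteq> \<Union>\<V>"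
    using conjunct2[OF K[unfolded compactin_def], rule_format, of "range ?U"] by blast
  obtain M where M: "finite M" "\<V> = ?U ` M" using finite_subset_image[OF \<V>(1,2)] by blast
  have "K \<inter> A (Max (insert 0 M)) = {}"
  proof (rule equals0I)
    fix p assume p: "p \<in> K \<inter> A (Max (insert 0 M))"
    then obtain m where m: "m \<in> M" "p \<in> ?U m" using \<V>(3) M(2) by blast
    have "m \<le> Max (insert 0 M)" using M(1) m(1) by (intro Max_ge) auto
    then have "p \<in> A m" using top_end_seq_decseq p by blast
    then show False using m(2) closure_of_subset[OF openin_subset[OF top_end_seq_open], of m] by blast
  qed
  then show ?thesis ..
qed

lemma connected_subset_region:
  assumes B: "connectedin (complex_topology G) B" and C: "C \<subseteq> verts G"
    and meet: "B \<inter> region G C \<noteq> {}" and avoid: "B \<inter> vertex_point ` (closed_nbhd G C - C) = {}"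
  shows "B \<subseteq> region G C"
  using connectedin_Int_frontier_of[OF B meet] frontier_region[OF G C] avoid by blast

text \<open>
  A connected set that contains an inner point of an edge \<open>uv\<close> but no vertex stays inside that edge,
  which is compact.
\<close>
lemma top_end_seq_has_vertex: "\<exists>x\<in>verts G. vertex_point x \<in> A n"
proof (rule ccontr)
  assume no: "\<not> (\<exists>x\<in>verts G. vertex_point x \<in> A n)"
  obtain p where p: "p \<in> A n" using top_end_seq_nonempty by blast
  then have pG: "p \<in> complex_points G" using top_end_seq_subset by blast
  obtain u v t where uv: "{u, v} \<in> edges G" "0 < t" "t < 1" "p = edge_point u v t"
    by (rule complex_points_cases[OF G pG]) (use no p in blast)+
  note ends = edge_endpoints[OF G uv(1)]
  have side: "A n \<subseteq> region G {w}" if "w \<in> {u, v}" for w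
  proof (rule connected_subset_region[OF top_end_seq_connected])
    show w: "{w} \<subseteq> verts G" using that ends by blast
    have "p \<in> region G {w}" using edge_in_region_iff[OF G uv(1), of t "{w}"] uv that by auto
    then show "A n \<inter> region G {w} \<noteq> {}" using p by blast
    have "closed_nbhd G {w} \<subseteq> verts G" using w G unfolding closed_nbhd_def is_graph_def by blast
    then show "A n \<inter> vertex_point ` (closed_nbhd G {w} - {w}) = {}" using no by blast
  qed
  have on_edge: "A n \<subseteq> edge_point u v ` {0..1}"
  proof
    fix q assume q: "q \<in> A n"
    then have pos: "0 < q u" "0 < q v" using side by (auto simp: region_def)
    have "q \<in> complex_points G" using q top_end_seq_subset by blast
    with G show "q \<in> edge_point u v ` {0..1}"
    proof (cases rule: complex_points_cases)
      case (vertex x)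
      then show ?thesis using no q by blast
    next
      case (inner u' v' s)
      have "u \<in> {u', v'}" "v \<in> {u', v'}"
        using pos unfolding inner(4) by (auto simp: edge_point_def split: if_splits)
      then consider "u = u'" "v = v'" | "u = v'" "v = u'" using ends(1) by auto
      then show ?thesis
      proof cases
        case 2
        then have "q = edge_point u v (1 - s)" using inner(4) edge_point_flip ends(1) by metis
        then show ?thesis using inner by auto
      qed (use inner in auto)
    qed
  qed
  obtain m where m: "edge_point u v ` {0..1} \<inter> A m = {}"
    using top_end_seq_leaves_compact[OF edge_compactin[OF G uv(1)]] by blast
  obtain q where "q \<in> A (max m n)" using top_end_seq_nonempty by blast
  then have "q \<in> A m" "q \<in> A n"
    using top_end_seq_decseq[of m "max m n"] top_end_seq_decseq[of n "max m n"] by auto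
  then show False using m on_edge by blast
qed

text \<open>
  The frontier of \<open>A k\<close> is compact, so the supports of its points have a finite union. After these
  vertices are deleted, the region of a component does not meet the frontier and hence, being
  connected, lies either inside or outside \<open>A k\<close>. The basis consists of the components whose regions
  contain a late \<open>A m\<close>.
\<close>
lemma top_end_seq_has_end_basis:
  obtains C where "end_basis G C" "\<forall>n. region G (C n) \<subseteq> A n" "\<forall>n. \<exists>m. A m \<subseteq> region G (C n)"
proof -
  define X where "X n = (\<Union>k\<le>n. \<Union>p\<in>complex_topology G frontier_of A k. support p)" for n
  have X: "finite (X n)" for n
    unfolding X_def using compact_finite_supports[OF G top_end_seq_frontier] by blast
  have XG: "X n \<subseteq> verts G" for n
    unfolding X_def
    using support_subset_verts(1)[OF G] frontier_of_subset_topspace[of "complex_topology G"]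
      topspace_complex[OF G] by (simp add: UN_subset_iff) blast
  have "\<exists>D. D \<in> graph_components (delete_verts G (X n)) \<and> (\<exists>m. A m \<subseteq> region G D)" for n
  proof -
    have "compactin (complex_topology G) (vertex_point ` X n)"
      using X XG topspace_complex[OF G] by (intro finite_imp_compactin) auto
    then obtain m where m: "vertex_point ` X n \<inter> A m = {}" using top_end_seq_leaves_compact by blast
    obtain x where x: "x \<in> verts G" "vertex_point x \<in> A m" using top_end_seq_has_vertex by blast
    define D where "D = {u \<in> verts (delete_verts G (X n)). (x, u) \<in> (adj (delete_verts G (X n)))\<^sup>*}"
    have "x \<notin> X n" using m x(2) by blast
    then have xD: "x \<in> D" and D: "D \<in> graph_components (delete_verts G (X n))"
      unfolding D_def graph_components_def using x(1) by auto
    have "A m \<subseteq> region G D"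
    proof (rule connected_subset_region[OF top_end_seq_connected])
      show "D \<subseteq> verts G" unfolding D_def by auto
      show "A m \<inter> region G D \<noteq> {}" using x xD vertex_in_region_iff[OF G] by blast
      show "A m \<inter> vertex_point ` (closed_nbhd G D - D) = {}" using m boundary_subset[OF G D] by blast
    qed
    with D show ?thesis by blast
  qed
  then have "\<forall>n. \<exists>D. D \<in> graph_components (delete_verts G (X n)) \<and> (\<exists>m. A m \<subseteq> region G D)" ..
  from choice[OF this] obtain C where
    C: "\<And>n. C n \<in> graph_components (delete_verts G (X n))" "\<And>n. \<exists>m. A m \<subseteq> region G (C n)" by blast
  have CG: "C n \<subseteq> verts G" "C n \<inter> X n = {}" for n using component_subset[OF C(1)[of n]] by auto
  have "C (Suc n) \<subseteq> C n" for n
  proof (rule connected_subset_component[OF C(1)])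
    show "(u, w) \<in> (Restr (adj G) (C (Suc n)))\<^sup>*" if "u \<in> C (Suc n)" "w \<in> C (Suc n)" for u w
      by (rule component_connected_delete_verts[OF G C(1) that])
    have "X n \<subseteq> X (Suc n)" unfolding X_def by (intro UN_mono) auto
    then show "C (Suc n) \<inter> X n = {}" using CG(2)[of "Suc n"] by blast
    obtain m m' where "A m \<subseteq> region G (C n)" "A m' \<subseteq> region G (C (Suc n))" using C(2) by blast
    moreover obtain x where "x \<in> verts G" "vertex_point x \<in> A (max m m')"
      using top_end_seq_has_vertex by blast
    moreover have "A (max m m') \<subseteq> A m" "A (max m m') \<subseteq> A m'" by (simp_all add: top_end_seq_decseq)
    ultimately show "C n \<inter> C (Suc n) \<noteq> {}" using vertex_in_region_iff[OF G] by blast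
  qed (rule CG(1))
  then have dec: "decseq C" by (simp add: decseq_Suc_iff)
  have inside: "region G (C n) \<subseteq> A n" for n
  proof -
    obtain m where m: "A m \<subseteq> region G (C n)" using C(2) by blast
    obtain q where "q \<in> A (max m n)" using top_end_seq_nonempty by blast
    then have "q \<in> A m" "q \<in> A n"
    using top_end_seq_decseq[of m "max m n"] top_end_seq_decseq[of n "max m n"] by auto
    then have meet: "region G (C n) \<inter> A n \<noteq> {}" using m by blast
    have "region G (C n) \<inter> complex_topology G frontier_of A n = {}"
    proof (rule equals0I)
      fix p assume p: "p \<in> region G (C n) \<inter> complex_topology G frontier_of A n"
      then obtain c where "c \<in> C n" "c \<in> support p" by (auto simp: region_def support_def)
      moreover have "support p \<subseteq> X n" unfolding X_def using p by blast
      ultimately show False using CG(2) by blast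
    qed
    then show ?thesis
      using connectedin_Int_frontier_of[OF connectedin_region_component[OF C(1)] meet] by blast
  qed
  have "\<exists>n. x \<notin> closed_nbhd G (C n)" if x: "x \<in> verts G" for x
  proof -
    obtain n where n: "vertex_point x \<notin> complex_topology G closure_of A n"
      using top_end_seq_Inter by blast
    then have "vertex_point x \<notin> complex_topology G closure_of region G (C n)"
      using closure_of_mono[OF inside] by blast
    then show ?thesis unfolding closure_region[OF G CG(1)] by blast
  qed
  moreover have "\<exists>X. finite X \<and> X \<subseteq> verts G \<and> C n \<in> graph_components (delete_verts G X)" for n
    using C(1)[of n] X[of n] XG[of n] by blast
  ultimately have "end_basis G C" unfolding end_basis_def using dec by simp
  with inside C(2) show ?thesis using that by blast
qed

end

section \<open>Rays of topological ends\<close>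

text \<open>
  For a sequence that represents a topological end, these are the rays of the end that \<open>\<phi>\<close> assigns
  to it.
\<close>
definition ray_of_seq :: "(nat \<Rightarrow> ('a \<Rightarrow> real) set) \<Rightarrow> (nat \<Rightarrow> 'a) \<Rightarrow> bool" where
  "ray_of_seq A r \<longleftrightarrow> is_ray G r \<and> (\<forall>n. has_tail_in_space (A n) r)"

lemma has_tail_in_region_iff:
  assumes r: "is_ray G r"
  shows "has_tail_in_space (region G C) r \<longleftrightarrow> (\<exists>N. \<forall>i\<ge>N. r i \<in> C)"
proof -
  have e: "{r i, r (Suc i)} \<in> edges G" "r i \<in> verts G" for i using r unfolding is_ray_def by auto
  show ?thesis
  proof
    assume "has_tail_in_space (region G C) r"
    then obtain N where N: "\<forall>i\<ge>N. edge_point (r i) (r (Suc i)) ` {0..1} \<subseteq> region G C"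
      unfolding has_tail_in_space_def by blast
    have "r i \<in> C" if "i \<ge> N" for i
    proof -
      have "0 \<in> {0..1::real}" by simp
      then have "edge_point (r i) (r (Suc i)) 0 \<in> region G C" using N that by blast
      then show ?thesis using vertex_in_region_iff[OF G e(2)] by (simp add: edge_point_0)
    qed
    then show "\<exists>N. \<forall>i\<ge>N. r i \<in> C" by blast
  next
    assume "\<exists>N. \<forall>i\<ge>N. r i \<in> C"
    then obtain N where N: "\<forall>i\<ge>N. r i \<in> C" by blast
    have "edge_point (r i) (r (Suc i)) t \<in> region G C" if "i \<ge> N" "t \<in> {0..1}" for i t
      using edge_in_region_iff[OF G e(1), of t i C] N that by (cases "t < 1") auto
    then show "has_tail_in_space (region G C) r" unfolding has_tail_in_space_def by blast
  qed
qed

lemma has_tail_in_space_mono: "has_tail_in_space U r \<Longrightarrow> U \<subseteq> V \<Longrightarrow> has_tail_in_space V r"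
  unfolding has_tail_in_space_def by blast

text \<open>
  The interlacing regions transfer every question about the sequence \<open>A\<close> to the basis \<open>C\<close>.
\<close>
lemma ray_of_seq_iff_follows:
  assumes r: "is_ray G r"
    and "\<forall>n. region G (C n) \<subseteq> A n" "\<forall>n. \<exists>m. A m \<subseteq> region G (C n)"
  shows "ray_of_seq A r \<longleftrightarrow> ray_follows C r"
proof -
  have "(\<forall>n. has_tail_in_space (A n) r) \<longleftrightarrow> (\<forall>n. has_tail_in_space (region G (C n)) r)"
    using assms(2,3) has_tail_in_space_mono by metis
  then show ?thesis
    unfolding ray_of_seq_def ray_follows_def using has_tail_in_region_iff[OF r] r by simp
qed

lemma top_end_seq_has_ray:
  assumes A: "is_top_end_seq G A"
  obtains r where "ray_of_seq A r"
proof -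
  obtain C where C: "end_basis G C" "\<forall>n. region G (C n) \<subseteq> A n" "\<forall>n. \<exists>m. A m \<subseteq> region G (C n)"
    using top_end_seq_has_end_basis[OF A] .
  obtain r where "is_ray G r" "ray_follows C r" using end_basis_has_ray[OF G C(1)] .
  then show ?thesis using that ray_of_seq_iff_follows[OF _ C(2,3)] by blast
qed

lemma ray_of_seq_nondominated:
  assumes A: "is_top_end_seq G A" and r: "ray_of_seq A r"
  shows "nondominated G r"
proof -
  obtain C where C: "end_basis G C" "\<forall>n. region G (C n) \<subseteq> A n" "\<forall>n. \<exists>m. A m \<subseteq> region G (C n)"
    using top_end_seq_has_end_basis[OF A] .
  have "is_ray G r" using r unfolding ray_of_seq_def by blast
  then show ?thesis
    using ray_follows_nondominated[OF G C(1)] ray_of_seq_iff_follows[OF _ C(2,3)] r by blast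
qed

lemma nondominated_ray_of_seq:
  assumes "is_ray G r" "nondominated G r"
  obtains A where "is_top_end_seq G A" "ray_of_seq A r"
proof -
  obtain C where C: "end_basis G C" "ray_follows C r"
    using nondominated_has_end_basis[OF G assms] .
  show ?thesis
    by (rule that[OF end_basis_top_end_seq[OF C(1)]])
      (use ray_of_seq_iff_follows[OF assms(1), of C "\<lambda>n. region G (C n)"] C(2) in blast)
qed

lemma ray_of_seq_ray_equiv_iff:
  assumes A: "is_top_end_seq G A" and r: "ray_of_seq A r" and s: "is_ray G s"
  shows "ray_of_seq A s \<longleftrightarrow> (r, s) \<in> ray_equiv G"
proof -
  obtain C where C: "end_basis G C" "\<forall>n. region G (C n) \<subseteq> A n" "\<forall>n. \<exists>m. A m \<subseteq> region G (C n)"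
    using top_end_seq_has_end_basis[OF A] .
  have r': "is_ray G r" using r unfolding ray_of_seq_def by blast
  show ?thesis
    using ray_follows_equiv_iff[OF G C(1) r' s] ray_of_seq_iff_follows[OF _ C(2,3)] r r' s by blast
qed

text \<open>
  If \<open>C n\<close> is a component of \<open>G - X\<close>, a late \<open>D m\<close> avoids \<open>X\<close>, and being connected it lies in the
  component of \<open>G - X\<close> that contains a tail of \<open>r\<close>, which is \<open>C n\<close>.
\<close>
lemma end_basis_refines:
  assumes C: "end_basis G C" "ray_follows C r" and D: "end_basis G D" "ray_follows D r"
  shows "\<exists>m. D m \<subseteq> C n"
proof -
  obtain X where X: "finite X" "C n \<in> graph_components (delete_verts G X)"
    using end_basis_component[OF G C(1)] by blast
  obtain m where "closed_nbhd G (D m) \<inter> X = {}" using end_basis_avoids[OF G D(1) X(1)] by blast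
  then have m: "D m \<inter> X = {}" using subset_closed_nbhd[of "D m" G] by blast
  obtain N where N: "\<forall>i\<ge>N. r i \<in> C n" using C(2) unfolding ray_follows_def by blast
  obtain M where M: "\<forall>i\<ge>M. r i \<in> D m" using D(2) unfolding ray_follows_def by blast
  have "r (max N M) \<in> C n \<inter> D m" using N M by simp
  then show ?thesis
    using connected_subset_component[OF X(2) end_basis_connected[OF G D(1)]
        end_basis_subset[OF G D(1)] m] by blast
qed

lemma ray_of_seq_refines:
  assumes A: "is_top_end_seq G A" "ray_of_seq A r" and B: "is_top_end_seq G B" "ray_of_seq B r"
  shows "\<exists>m. B m \<subseteq> A n"
proof -
  obtain C where C: "end_basis G C" "\<forall>n. region G (C n) \<subseteq> A n" "\<forall>n. \<exists>m. A m \<subseteq> region G (C n)"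
    using top_end_seq_has_end_basis[OF A(1)] .
  obtain D where D: "end_basis G D" "\<forall>n. region G (D n) \<subseteq> B n" "\<forall>n. \<exists>m. B m \<subseteq> region G (D n)"
    using top_end_seq_has_end_basis[OF B(1)] .
  have r: "is_ray G r" using A(2) unfolding ray_of_seq_def by blast
  have "ray_follows C r" "ray_follows D r"
    using ray_of_seq_iff_follows[OF r C(2,3)] ray_of_seq_iff_follows[OF r D(2,3)] A(2) B(2) by blast+
  then obtain m where "D m \<subseteq> C n" using end_basis_refines C(1) D(1) by blast
  moreover obtain k where "B k \<subseteq> region G (D m)" using D(3) by blast
  ultimately have "B k \<subseteq> A n" using region_mono[OF G] C(2) by blast
  then show ?thesis ..
qed

text \<open>
  This says that \<open>\<phi>\<close> is well defined and injective.
\<close>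
lemma top_end_equiv_iff_ray_equiv:
  assumes A: "is_top_end_seq G A" "ray_of_seq A r" and B: "is_top_end_seq G B" "ray_of_seq B s"
  shows "(A, B) \<in> top_end_equiv G \<longleftrightarrow> (r, s) \<in> ray_equiv G"
proof
  have rs: "is_ray G r" "is_ray G s" using A(2) B(2) unfolding ray_of_seq_def by blast+
  {
    assume AB: "(A, B) \<in> top_end_equiv G"
    have "ray_of_seq A s"
      unfolding ray_of_seq_def
    proof (intro conjI allI)
      fix n
      obtain m where "B m \<subseteq> A n" using AB unfolding top_end_equiv_def by blast
      then show "has_tail_in_space (A n) s"
        using B(2) has_tail_in_space_mono unfolding ray_of_seq_def by blast
    qed (rule rs)
    then show "(r, s) \<in> ray_equiv G" using ray_of_seq_ray_equiv_iff[OF A rs(2)] by blast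
  next
    assume "(r, s) \<in> ray_equiv G"
    then have "ray_of_seq A s" using ray_of_seq_ray_equiv_iff[OF A rs(2)] by blast
    then have "\<exists>m. B m \<subseteq> A n" "\<exists>k. A k \<subseteq> B n" for n
      using ray_of_seq_refines A(1) B by blast+
    then show "(A, B) \<in> top_end_equiv G" unfolding top_end_equiv_def using A(1) B(1) by blast
  }
qed

lemma top_end_to_end_eq:
  assumes A: "is_top_end_seq G A" "ray_of_seq A r"
  shows "top_end_to_end G (top_end_equiv G `` {A}) = ray_equiv G `` {r}"
  unfolding top_end_to_end_def
proof (rule the_equality)
  \<comment> \<open>Equivalent sequences have the same rays, so the rays with tails in all members of \<open>A\<close> have
    tails in the members of every representative \<open>B\<close>.\<close>
  have r: "is_ray G r" using A(2) unfolding ray_of_seq_def by blast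
  have "has_tail_in_space (B n) s" if "(A, B) \<in> top_end_equiv G" "(r, s) \<in> ray_equiv G" for B s n
  proof -
    have s: "is_ray G s" using that(2) unfolding ray_equiv_iff by blast
    have B: "is_top_end_seq G B" using that(1) unfolding top_end_equiv_def by blast
    obtain t where t: "ray_of_seq B t" using top_end_seq_has_ray[OF B] .
    have "(r, t) \<in> ray_equiv G" using top_end_equiv_iff_ray_equiv[OF A B t] that(1) by blast
    then have "(t, s) \<in> ray_equiv G"
      using that(2) equiv_ray_equiv[of G] by (meson equivE symD transD)
    then show ?thesis using ray_of_seq_ray_equiv_iff[OF B t s] unfolding ray_of_seq_def by blast
  qed
  then show "ray_equiv G `` {r} \<in> ends G \<and>
      (\<forall>B\<in>top_end_equiv G `` {A}. \<forall>s\<in>ray_equiv G `` {r}. \<forall>n. has_tail_in_space (B n) s)"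
    using r unfolding ends_def by (auto intro: quotientI)
  fix \<omega> assume \<omega>: "\<omega> \<in> ends G \<and> (\<forall>B\<in>top_end_equiv G `` {A}. \<forall>s\<in>\<omega>. \<forall>n. has_tail_in_space (B n) s)"
  then obtain s where s: "is_ray G s" "\<omega> = ray_equiv G `` {s}"
    unfolding ends_def by (auto elim: quotientE)
  have "A \<in> top_end_equiv G `` {A}" "s \<in> \<omega>"
    using equiv_class_self[OF equiv_top_end_equiv[of G]] equiv_class_self[OF equiv_ray_equiv[of G]]
      A(1) s by auto
  then have "ray_of_seq A s" using \<omega> s(1) unfolding ray_of_seq_def by blast
  then have "(r, s) \<in> ray_equiv G" using ray_of_seq_ray_equiv_iff[OF A s(1)] by blast
  then show "\<omega> = ray_equiv G `` {r}" using equiv_class_eq[OF equiv_ray_equiv] s(2) by blast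
qed

lemma end_to_edge_end_eq:
  assumes r: "is_ray G r"
  shows "end_to_edge_end G (ray_equiv G `` {r}) = ray_edge_equiv G `` {r}"
proof -
  have "ray_edge_equiv G `` {s} = ray_edge_equiv G `` {r}" if "(r, s) \<in> ray_equiv G" for s
    using equiv_class_eq[OF equiv_ray_edge_equiv ray_equiv_imp_edge_equiv[OF G that]] by simp
  moreover have "r \<in> ray_equiv G `` {r}" using equiv_class_self[OF equiv_ray_equiv] r by blast
  ultimately have "(\<lambda>s. ray_edge_equiv G `` {s}) ` (ray_equiv G `` {r}) = {ray_edge_equiv G `` {r}}"
    by blast
  then show ?thesis unfolding end_to_edge_end_def by simp
qed

text \<open>
  The map is determined by the triangle, so only its injectivity is at stake; and \<open>\<phi>\<close> identifies the
  topological ends with the non-dominated ends.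
\<close>
theorem top_ends_inject_iff_end_correlated:
  "(\<exists>f. f \<in> top_ends G \<rightarrow> edge_ends G \<and> inj_on f (top_ends G) \<and>
      (\<forall>\<epsilon>\<in>top_ends G. f \<epsilon> = end_to_edge_end G (top_end_to_end G \<epsilon>))) \<longleftrightarrow> end_correlated G"
    (is "?L \<longleftrightarrow> _")
proof
  let ?f = "\<lambda>\<epsilon>. end_to_edge_end G (top_end_to_end G \<epsilon>)"
  have f: "?f (top_end_equiv G `` {A}) = ray_edge_equiv G `` {r}"
    if "is_top_end_seq G A" "ray_of_seq A r" for A r
    unfolding top_end_to_end_eq[OF that] using that(2)
    by (intro end_to_edge_end_eq) (simp add: ray_of_seq_def)
  {
    assume ?L
    then have inj: "inj_on ?f (top_ends G)" by (metis (no_types, lifting) inj_on_cong)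
    show "end_correlated G"
      unfolding end_correlated_def
    proof (intro allI impI, elim conjE)
      fix r s
      assume r: "is_ray G r" "nondominated G r" and s: "is_ray G s" "nondominated G s"
        and rs: "(r, s) \<in> ray_edge_equiv G"
      obtain A where A: "is_top_end_seq G A" "ray_of_seq A r" using nondominated_ray_of_seq[OF r] .
      obtain B where B: "is_top_end_seq G B" "ray_of_seq B s" using nondominated_ray_of_seq[OF s] .
      have "?f (top_end_equiv G `` {A}) = ?f (top_end_equiv G `` {B})"
        unfolding f[OF A] f[OF B] by (rule equiv_class_eq[OF equiv_ray_edge_equiv rs])
      then have "top_end_equiv G `` {A} = top_end_equiv G `` {B}"
        by (rule inj_onD[OF inj]) (use A(1) B(1) in \<open>auto simp: top_ends_def intro: quotientI\<close>)
      then have "(A, B) \<in> top_end_equiv G"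
        using eq_equiv_class[OF _ equiv_top_end_equiv] B(1) by blast
      then show "(r, s) \<in> ray_equiv G" using top_end_equiv_iff_ray_equiv[OF A B] by blast
    qed
  next
    assume cor: "end_correlated G"
    have rep: "\<exists>A r. is_top_end_seq G A \<and> ray_of_seq A r \<and> \<epsilon> = top_end_equiv G `` {A}"
      if \<epsilon>: "\<epsilon> \<in> top_ends G" for \<epsilon>
    proof -
      obtain A where "is_top_end_seq G A" "\<epsilon> = top_end_equiv G `` {A}"
        using \<epsilon> unfolding top_ends_def quotient_def by blast
      then show ?thesis using top_end_seq_has_ray by metis
    qed
    have "?f \<epsilon> \<in> edge_ends G" if "\<epsilon> \<in> top_ends G" for \<epsilon>
    proof -
      obtain A r where A: "is_top_end_seq G A" "ray_of_seq A r" "\<epsilon> = top_end_equiv G `` {A}"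
        using rep \<open>\<epsilon> \<in> top_ends G\<close> by blast
      then show ?thesis
        using f[OF A(1,2)] unfolding edge_ends_def ray_of_seq_def by (auto intro: quotientI)
    qed
    moreover have "inj_on ?f (top_ends G)"
    proof (rule inj_onI)
      fix \<epsilon> \<eta> assume "\<epsilon> \<in> top_ends G" "\<eta> \<in> top_ends G" and eq: "?f \<epsilon> = ?f \<eta>"
      then obtain A r B s where A: "is_top_end_seq G A" "ray_of_seq A r" "\<epsilon> = top_end_equiv G `` {A}"
        and B: "is_top_end_seq G B" "ray_of_seq B s" "\<eta> = top_end_equiv G `` {B}"
        using rep by metis
      have rs: "is_ray G r" "is_ray G s" using A(2) B(2) unfolding ray_of_seq_def by blast+
      have "ray_edge_equiv G `` {r} = ray_edge_equiv G `` {s}"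
        using eq unfolding A(3) B(3) f[OF A(1,2)] f[OF B(1,2)] .
      then have "(r, s) \<in> ray_edge_equiv G"
        using eq_equiv_class[OF _ equiv_ray_edge_equiv] rs(2) by blast
      then have "(r, s) \<in> ray_equiv G"
        using cor rs ray_of_seq_nondominated[OF A(1,2)] ray_of_seq_nondominated[OF B(1,2)]
        unfolding end_correlated_def by blast
      then have "(A, B) \<in> top_end_equiv G"
        using top_end_equiv_iff_ray_equiv[OF A(1,2) B(1,2)] by blast
      then show "\<epsilon> = \<eta>" unfolding A(3) B(3) by (rule equiv_class_eq[OF equiv_top_end_equiv])
    qed
    ultimately show ?L by (intro exI[of _ ?f]) blast
  }
qed

end

theorem theorem2p7:
  fixes G :: "'a ugraph"
  assumes "is_graph G" and "infinite (verts G)"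
  defines "S1 \<equiv> \<exists>f\<^sub>E. f\<^sub>E \<in> top_ends G \<rightarrow> edge_ends G \<and> inj_on f\<^sub>E (top_ends G) \<and>
                  (\<forall>\<epsilon>\<in>top_ends G. f\<^sub>E \<epsilon> = end_to_edge_end G (top_end_to_end G \<epsilon>))"
    and "S2 \<equiv> end_correlated G"
    and "S3 \<equiv> \<forall>F v. finite F \<and> F \<subseteq> verts G \<and> v \<in> verts G \<longrightarrow>
                  (\<exists>\<^sub>\<le>\<^sub>1 C. C \<in> graph_components (delete_verts G F) \<and>
                     (\<exists>r. is_ray G r \<and> nondominated G r \<and> contains_ray (edge_class G v \<inter> C) r))"
  shows "(S1 \<longleftrightarrow> S2) \<and> (S2 \<longleftrightarrow> S3)"
  unfolding S1_def S2_def S3_def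
  using top_ends_inject_iff_end_correlated[OF assms(1)] end_correlated_iff_edge_classes[OF assms(1)]
  by blast

end
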